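(* Let $G$ be a $P_5$-free graph with $\omega(G)\ge 3$. Then $\chi(G)\le \omega(G)^{\log_2(\omega(G))}$.
   Context: Graphs are finite and simple. $P_5$ denotes the path with five vertices. A graph $G$ is $H$-free if no induced subgraph of $G$ is isomorphic to $H$. $\chi(G)$ denotes the chromatic number of $G$, and $\omega(G)$ denotes the size of the largest clique of $G$. *)

theory Defs
  imports Complex_Main "Graph_Theory.Graph_Theory"
begin

text \<open>
  A finite simple graph is a \<open>pre_digraph\<close> satisfying the library predicate \<open>graph\<close>
  (finite, symmetric, without loops and without parallel arcs): an undirected edge
  between \<open>u\<close> and \<open>v\<close> is the pair of arcs \<open>u \<rightarrow> v\<close> and \<open>v \<rightarrow> u\<close>. Adjacency is the
  library relation \<open>dominates\<close>. On symmetric digraphs \<open>induced_subgraph\<close> and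
  \<open>digraph_iso\<close> are the induced subgraphs and isomorphisms of undirected graphs.
\<close>

definition path_graph :: "nat \<Rightarrow> nat pair_pre_digraph" where
  "path_graph n = \<lparr> pverts = {..<n}, parcs = {(i, j). i < n \<and> j < n \<and> (j = Suc i \<or> i = Suc j)} \<rparr>"

definition H_free :: "('c, 'd) pre_digraph \<Rightarrow> ('a, 'b) pre_digraph \<Rightarrow> bool" where
  "H_free H G \<longleftrightarrow> \<not> (\<exists>K. induced_subgraph K G \<and> digraph_iso K H)"

definition clique :: "('a, 'b) pre_digraph \<Rightarrow> 'a set \<Rightarrow> bool" where
  "clique G K \<longleftrightarrow> K \<subseteq> verts G \<and> (\<forall>u\<in>K. \<forall>v\<in>K. u \<noteq> v \<longrightarrow> u \<rightarrow>\<^bsub>G\<^esub> v)"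

definition clique_number :: "('a, 'b) pre_digraph \<Rightarrow> nat" where
  "clique_number G = Max (card ` {K. clique G K})"

definition proper_colouring :: "('a, 'b) pre_digraph \<Rightarrow> nat \<Rightarrow> ('a \<Rightarrow> nat) \<Rightarrow> bool" where
  "proper_colouring G k c \<longleftrightarrow>
     (\<forall>v \<in> verts G. c v < k) \<and> (\<forall>u v. u \<rightarrow>\<^bsub>G\<^esub> v \<longrightarrow> c u \<noteq> c v)"

definition chromatic_number :: "('a, 'b) pre_digraph \<Rightarrow> nat" where
  "chromatic_number G = (LEAST k. \<exists>c. proper_colouring G k c)"

lemma graph_path_graph: "graph (with_proj (path_graph n))"
proof -
  have "parcs (path_graph n) \<subseteq> {..<n} \<times> {..<n}"
    by (auto simp: path_graph_def)
  then have "finite (parcs (path_graph n))"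
    by (rule finite_subset) simp
  then show ?thesis
    by unfold_locales (auto simp: path_graph_def arc_to_ends_def symmetric_def sym_def)
qed

text \<open>On finite simple graphs, \<open>Max\<close> and \<open>LEAST\<close> above are taken over suitable sets.\<close>

lemma cliques_finite_nonempty:
  assumes "graph G"
  shows "finite {K. clique G K}" and "{K. clique G K} \<noteq> {}"
proof -
  interpret graph G by fact
  have "{K. clique G K} \<subseteq> Pow (verts G)"
    by (auto simp: clique_def)
  then show "finite {K. clique G K}"
    by (rule finite_subset) simp
  have "clique G {}"
    by (simp add: clique_def)
  then show "{K. clique G K} \<noteq> {}"
    by blast
qed

lemma proper_colouring_exists:
  assumes "graph G"
  shows "\<exists>k c. proper_colouring G k c"
proof -
  interpret graph G by fact
  obtain c :: "'a \<Rightarrow> nat" where c: "bij_betw c (verts G) {0..<card (verts G)}"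
    using ex_bij_betw_finite_nat[OF finite_verts] by blast
  have "proper_colouring G (card (verts G)) c"
    unfolding proper_colouring_def
  proof (intro conjI allI impI ballI)
    fix v assume "v \<in> verts G"
    then show "c v < card (verts G)" using bij_betwE[OF c] by auto
  next
    fix u v assume uv: "u \<rightarrow>\<^bsub>G\<^esub> v"
    then have "u \<in> verts G" "v \<in> verts G" "u \<noteq> v"
      by (auto dest: adj_in_verts adj_not_same)
    then show "c u \<noteq> c v"
      using bij_betw_imp_inj_on[OF c] by (auto dest: inj_onD)
  qed
  then show ?thesis by blast
qed

end

theory Submission
  imports Defs
begin

text \<open>
  Everything happens for a symmetric, irreflexive relation \<open>E\<close> with no induced path on five vertices,
  and a bound means: every finite set whose cliques have at most \<open>w\<close> elements has a colouring with
  \<open>k\<close> colours. The exponent \<open>log\<^sub>2 w\<close> comes from the recursion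
  \<open>f w = f (w - 1) + (w + 2) * f (w div 2)\<close>: lowering \<open>w\<close> by one costs only linearly many copies of
  the bound for half the clique number, and \<open>w powr log 2 w\<close> satisfies this recursion from
  \<open>w = 6\<close> on.

  The recursion (\<open>chi_bound_rec\<close>). Write \<open>m = w div 2\<close>. The set of vertices complete to a
  clique with \<open>m + 1\<close> elements has clique number at most \<open>w - m - 1\<close>, so it is cheap to colour. The
  absence of an induced five-vertex path makes vertices complete: if \<open>X\<close> separates the connected sets
  \<open>C\<close> and \<open>D\<close> and a vertex of \<open>X\<close> has neighbours in both, it is complete to one of them
  (\<open>separates_complete\<close>). Hence, when two cliques with \<open>m + 1\<close> elements have no edge between them, a
  minimal cutset between them is cheap, and the rest costs one copy of \<open>f (w - 1)\<close> and linearly many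
  cheap ones (\<open>cutset_bound\<close>). When there are no two such cliques, take a minimal cutset with a
  component \<open>C\<close> that contains a large clique and another component \<open>D\<close> that is as large as possible.
  The part of the cutset that is complete to \<open>C\<close> is cheap. The other part is complete to \<open>D\<close>; maximality
  of \<open>D\<close> makes the non-neighbours in \<open>C\<close> of each of its vertices cheap, so if it contains a
  clique with \<open>m + 1\<close> elements, then \<open>C\<close> is a union of \<open>m + 2\<close> cheap sets,
  and if not, the whole cutset is cheap (\<open>bound_if_no_anti_cliques\<close>).

  The start of the recursion is the delicate part, because \<open>3 powr log 2 3\<close> is less than 6: clique
  number three needs five colours, clique number two needs three, and then \<open>4\<close> and \<open>5\<close> follow from the
  recursion with the values 16 and 37. Triangle-free sets are 3-colourable
  (\<open>triangle_free_colourable\<close>), so it is enough to find two stable sets whose removal destroys all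
  triangles. If two edges have no edge between them, a minimal cutset between them splits into two stable sets.
  When both are nonempty, every component is triangle-free or there is a stable cutset; otherwise the
  cutset itself is stable; and a stable cutset always suffices (\<open>stable_cutset\<close>). If every two edges
  meet or are joined by an edge, look at a vertex \<open>d\<close>. Its neighbourhood is triangle-free. If it is
  bipartite, two colours for it and three for the non-neighbours of \<open>d\<close> are enough (one and four, if it
  is stable). Otherwise
  it contains a five-cycle, and one of two classes of vertices in the neighbourhood that attach to the cycle
  in the same way can be taken as a colour class (\<open>five_colourable_unsplit\<close>, \<open>splits_incompatible\<close>).
\<close>

section \<open>Graphs, colourings and connected sets\<close>

locale sgraph =
  fixes E :: "'a \<Rightarrow> 'a \<Rightarrow> bool"
  assumes adj_sym: "E x y \<Longrightarrow> E y x" and adj_irrefl: "\<not> E x x"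
begin

definition stable :: "'a set \<Rightarrow> bool" where
  "stable S \<longleftrightarrow> (\<forall>u\<in>S. \<forall>v\<in>S. \<not> E u v)"

definition anticomplete :: "'a set \<Rightarrow> 'a set \<Rightarrow> bool" where
  "anticomplete A B \<longleftrightarrow> (\<forall>a\<in>A. \<forall>b\<in>B. \<not> E a b)"

definition is_clique :: "'a set \<Rightarrow> bool" where
  "is_clique K \<longleftrightarrow> (\<forall>u\<in>K. \<forall>v\<in>K. u \<noteq> v \<longrightarrow> E u v)"

definition clique_le :: "'a set \<Rightarrow> nat \<Rightarrow> bool" where
  "clique_le S k \<longleftrightarrow> (\<forall>K. K \<subseteq> S \<longrightarrow> is_clique K \<longrightarrow> card K \<le> k)"

definition colourable :: "'a set \<Rightarrow> nat \<Rightarrow> bool" where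
  "colourable S k \<longleftrightarrow> (\<exists>c::'a \<Rightarrow> nat. (\<forall>v\<in>S. c v < k) \<and> (\<forall>u\<in>S. \<forall>v\<in>S. E u v \<longrightarrow> c u \<noteq> c v))"

definition trifree :: "'a set \<Rightarrow> bool" where
  "trifree S \<longleftrightarrow> (\<forall>a\<in>S. \<forall>b\<in>S. \<forall>c\<in>S. \<not> (E a b \<and> E b c \<and> E a c))"

text \<open>Connectedness is phrased through cuts rather than paths, so that an argument about a path becomes an
argument about one edge leaving a well-chosen part.\<close>

definition conn_set :: "'a set \<Rightarrow> bool" where
  "conn_set A \<longleftrightarrow> A \<noteq> {} \<and> (\<forall>B. B \<subseteq> A \<longrightarrow> B \<noteq> {} \<longrightarrow> B \<noteq> A \<longrightarrow> (\<exists>x\<in>B. \<exists>y\<in>A - B. E x y))"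

definition component :: "'a set \<Rightarrow> 'a \<Rightarrow> 'a set" where
  "component S u = \<Union>{A. A \<subseteq> S \<and> u \<in> A \<and> conn_set A}"

lemma colourable_mono: "colourable S k \<Longrightarrow> T \<subseteq> S \<Longrightarrow> k \<le> l \<Longrightarrow> colourable T l"
proof -
  assume a: "colourable S k" "T \<subseteq> S" "k \<le> l"
  obtain c where c: "\<forall>v\<in>S. c v < k" "\<forall>u\<in>S. \<forall>v\<in>S. E u v \<longrightarrow> c u \<noteq> c v"
    using a(1) unfolding colourable_def by blast
  have "\<forall>v\<in>T. c v < l" using c(1) a(2,3) by fastforce
  moreover have "\<forall>u\<in>T. \<forall>v\<in>T. E u v \<longrightarrow> c u \<noteq> c v" using c(2) a(2) by blast
  ultimately show "colourable T l" unfolding colourable_def by blast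
qed

lemma colourable_Un:
  assumes "colourable A i" "colourable B j" shows "colourable (A \<union> B) (i + j)"
proof -
  obtain c where c: "\<forall>v\<in>A. c v < i" "\<forall>u\<in>A. \<forall>v\<in>A. E u v \<longrightarrow> c u \<noteq> c v"
    using assms(1) by (auto simp: colourable_def)
  obtain d where d: "\<forall>v\<in>B. d v < j" "\<forall>u\<in>B. \<forall>v\<in>B. E u v \<longrightarrow> d u \<noteq> d v"
    using assms(2) by (auto simp: colourable_def)
  show ?thesis unfolding colourable_def
    apply (rule exI[of _ "\<lambda>v. if v \<in> A then c v else i + d v"])
    using c d by (auto simp: trans_less_add1)
qed

lemma colourable_cover:
  assumes "colourable A i" "colourable B j" "S \<subseteq> A \<union> B" "i + j \<le> k" shows "colourable S k"
  using colourable_mono[OF colourable_Un[OF assms(1,2)] assms(3,4)] .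

lemma colourable_anti:
  assumes "colourable A k" "colourable B k" "anticomplete A B" shows "colourable (A \<union> B) k"
proof -
  obtain c where c: "\<forall>v\<in>A. c v < k" "\<forall>u\<in>A. \<forall>v\<in>A. E u v \<longrightarrow> c u \<noteq> c v"
    using assms(1) by (auto simp: colourable_def)
  obtain d where d: "\<forall>v\<in>B. d v < k" "\<forall>u\<in>B. \<forall>v\<in>B. E u v \<longrightarrow> d u \<noteq> d v"
    using assms(2) by (auto simp: colourable_def)
  have a: "\<not> E u v \<and> \<not> E v u" if "u \<in> A" "v \<in> B" for u v
    using assms(3) that unfolding anticomplete_def by (metis adj_sym)
  show ?thesis unfolding colourable_def
    apply (rule exI[of _ "\<lambda>v. if v \<in> A then c v else d v"])
    using c d a by auto
qed

lemma colourable_stable: "stable S \<Longrightarrow> colourable S 1"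
  unfolding colourable_def stable_def by (rule exI[of _ "\<lambda>_. 0"]) auto

lemma colourable_empty: "colourable {} k"
  by (simp add: colourable_def)

lemma stable_mono: "stable S \<Longrightarrow> T \<subseteq> S \<Longrightarrow> stable T"
  by (auto simp: stable_def)

lemma clique_le_mono: "clique_le S k \<Longrightarrow> T \<subseteq> S \<Longrightarrow> k \<le> l \<Longrightarrow> clique_le T l"
  unfolding clique_le_def by (meson order.trans)

lemma conn_single: "conn_set {u}"
  by (auto simp: conn_set_def)

lemma conn_edge: "conn_set A \<Longrightarrow> B \<subseteq> A \<Longrightarrow> b \<in> B \<Longrightarrow> a \<in> A \<Longrightarrow> a \<notin> B \<Longrightarrow> \<exists>x\<in>B. \<exists>y\<in>A - B. E x y"
  unfolding conn_set_def by blast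

text \<open>The way connectedness is used against induced paths: a vertex with a neighbour and a non-neighbour in
a connected set sees exactly one end of some edge of that set, which prolongs a path by two vertices.\<close>

lemma conn_mixed:
  assumes "conn_set A" "a \<in> A" "E y a" "b \<in> A" "\<not> E y b"
  obtains p q where "p \<in> A" "q \<in> A" "E y p" "\<not> E y q" "E p q"
  using conn_edge[OF assms(1), of "{x\<in>A. E y x}" a b] assms by blast

lemma conn_Union:
  assumes c: "\<And>A. A \<in> F \<Longrightarrow> conn_set A" and u: "\<And>A. A \<in> F \<Longrightarrow> u \<in> A" and ne: "F \<noteq> {}"
  shows "conn_set (\<Union>F)"
  unfolding conn_set_def
proof (intro conjI allI impI)
  from ne obtain A where "A \<in> F" by blast
  then show "\<Union>F \<noteq> {}" using u[of A] by blast
  fix B assume B: "B \<subseteq> \<Union>F" "B \<noteq> {}" "B \<noteq> \<Union>F"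
  obtain b0 A0 where b0: "b0 \<in> B" "A0 \<in> F" "b0 \<in> A0" using B(1,2) by blast
  obtain a1 A1 where a1: "a1 \<notin> B" "A1 \<in> F" "a1 \<in> A1" using B(1,3) by blast
  obtain A b a where A: "A \<in> F" "b \<in> A" "b \<in> B" "a \<in> A" "a \<notin> B"
  proof (cases "u \<in> B")
    case True then show ?thesis using that[OF a1(2) u[OF a1(2)] True a1(3,1)] by simp
  next
    case False then show ?thesis using that[OF b0(2,3,1) u[OF b0(2)] False] by simp
  qed
  have "\<exists>x\<in>A \<inter> B. \<exists>y\<in>A - A \<inter> B. E x y"
    by (rule conn_edge[OF c[OF A(1)], of _ b a]) (use A in auto)
  then show "\<exists>x\<in>B. \<exists>y\<in>\<Union>F - B. E x y" using A(1) by auto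
qed

lemma conn_Un: "conn_set A \<Longrightarrow> conn_set B \<Longrightarrow> u \<in> A \<Longrightarrow> u \<in> B \<Longrightarrow> conn_set (A \<union> B)"
  using conn_Union[of "{A, B}" u] by fastforce

lemma conn_pair: "E x y \<Longrightarrow> conn_set {x, y}"
  unfolding conn_set_def
proof (intro conjI allI impI)
  fix B assume "E x y" "B \<subseteq> {x, y}" "B \<noteq> {}" "B \<noteq> {x, y}"
  then have "B = {x} \<or> B = {y}" and "E y x" "x \<noteq> y" using adj_sym adj_irrefl by auto
  then show "\<exists>xa\<in>B. \<exists>y\<in>{x, y} - B. E xa y" using \<open>E x y\<close> by auto
qed simp

lemma conn_insert: "conn_set A \<Longrightarrow> a \<in> A \<Longrightarrow> E x a \<Longrightarrow> conn_set (insert x A)"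
  using conn_Un[of "{x, a}" A a] conn_pair[of x a] by (simp add: insert_absorb)

lemma conn_clique: assumes "is_clique K" "K \<noteq> {}" shows "conn_set K"
  unfolding conn_set_def
proof (intro conjI allI impI)
  fix B assume "B \<subseteq> K" "B \<noteq> {}" "B \<noteq> K"
  then obtain x y where xy: "x \<in> B" "y \<in> K" "y \<notin> B" by (metis equals0I subset_antisym subsetI)
  then have "E x y" using assms(1) \<open>B \<subseteq> K\<close> unfolding is_clique_def by (metis subsetD)
  then show "\<exists>x\<in>B. \<exists>y\<in>K - B. E x y" using xy by auto
qed (rule assms)

lemma component_sub: "component S u \<subseteq> S"
  by (auto simp: component_def)

lemma component_refl: "u \<in> S \<Longrightarrow> u \<in> component S u"
  unfolding component_def using conn_single[of u] by blast

lemma component_conn: "u \<in> S \<Longrightarrow> conn_set (component S u)"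
  unfolding component_def by (rule conn_Union[of _ u]) (use conn_single[of u] in auto)

lemma component_max: "conn_set A \<Longrightarrow> A \<subseteq> S \<Longrightarrow> a \<in> A \<Longrightarrow> a \<in> component S u \<Longrightarrow> A \<subseteq> component S u"
proof -
  assume A: "conn_set A" "A \<subseteq> S" "a \<in> A" "a \<in> component S u"
  from A(4) obtain B where B: "B \<subseteq> S" "u \<in> B" "conn_set B" "a \<in> B" unfolding component_def by blast
  have "conn_set (A \<union> B)" by (rule conn_Un[OF A(1) B(3) A(3) B(4)])
  then have "A \<union> B \<in> {A. A \<subseteq> S \<and> u \<in> A \<and> conn_set A}" using A B by simp
  then have "A \<union> B \<subseteq> component S u" unfolding component_def by (rule Union_upper)
  then show ?thesis by simp
qed

lemma component_step: "v \<in> component S u \<Longrightarrow> E v w \<Longrightarrow> w \<in> S \<Longrightarrow> w \<in> component S u"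
  using component_max[OF conn_pair, of v w S v u] component_sub by blast

lemma component_eq: assumes "v \<in> component S u" shows "component S v = component S u"
proof -
  have S: "v \<in> S" using assms component_sub by blast
  have "u \<in> S" using assms unfolding component_def by blast
  note S = S this
  have u: "u \<in> component S v"
    using component_max[OF component_conn[OF S(2)] component_sub assms component_refl[OF S(1)]] component_refl S by blast
  show ?thesis
    using component_max[OF component_conn[OF S(2)] component_sub assms component_refl[OF S(1)]]
      component_max[OF component_conn[OF S(1)] component_sub u component_refl[OF S(2)]] by blast
qed

text \<open>The set \<open>W\<close> allows components from which parts have already been removed.\<close>

lemma colourable_comps:
  assumes "\<And>u. u \<in> S \<Longrightarrow> colourable (component S u \<inter> W) k" shows "colourable (S \<inter> W) k"
proof -
  define P where "P A c \<longleftrightarrow> (\<forall>v\<in>A \<inter> W. c v < k) \<and> (\<forall>u\<in>A \<inter> W. \<forall>v\<in>A \<inter> W. E u v \<longrightarrow> c u \<noteq> c v)"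
    for A and c :: "'a \<Rightarrow> nat"
  have "\<exists>c. P (component S u) c" if "u \<in> S" for u
    using assms[OF that] by (auto simp: colourable_def P_def)
  then have g: "P (component S u) (SOME c. P (component S u) c)" if "u \<in> S" for u
    using that by (metis someI_ex)
  define c where "c v = (SOME c. P (component S v) c) v" for v
  have "c u < k" if "u \<in> S \<inter> W" for u
    using g[of u] that component_refl[of u S] by (auto simp: P_def c_def)
  moreover have "c u \<noteq> c v" if "u \<in> S \<inter> W" "v \<in> S \<inter> W" "E u v" for u v
  proof -
    have v: "v \<in> component S u" using component_step[OF component_refl that(3)] that by blast
    then have "component S v = component S u" by (rule component_eq)
    then show ?thesis using g[of u] that v component_refl[of u S] by (auto simp: P_def c_def)
  qed
  ultimately show ?thesis unfolding colourable_def by blast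
qed

lemma colourable_comps': "(\<And>u. u \<in> S \<Longrightarrow> colourable (component S u) k) \<Longrightarrow> colourable S k"
  using colourable_comps[of S UNIV k] by simp

lemma component_bdry:
  assumes "conn_set C" "x \<in> C" "x \<notin> component S r" "r \<in> S" "S \<subseteq> C"
  obtains y t where "y \<in> C" "y \<notin> S" "t \<in> component S r" "E t y"
proof -
  have "\<exists>t\<in>component S r. \<exists>y\<in>C - component S r. E t y"
    using conn_edge[OF assms(1) _ component_refl[OF assms(4)] assms(2,3)] component_sub[of S r] assms(5) by blast
  then show thesis using that component_step[of _ S r] by blast
qed

text \<open>A minimal cutset of \<open>V\<close>, together with two of the components that witness its minimality.\<close>

definition separates :: "'a set \<Rightarrow> 'a set \<Rightarrow> 'a set \<Rightarrow> 'a set \<Rightarrow> bool" where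
  "separates V X C D \<longleftrightarrow> X \<subseteq> V \<and> (\<exists>c\<in>V - X. C = component (V - X) c) \<and> (\<exists>d\<in>V - X. D = component (V - X) d) \<and> C \<noteq> D \<and>
     (\<forall>x\<in>X. (\<exists>c\<in>C. E x c) \<and> (\<exists>d\<in>D. E x d))"

text \<open>Let \<open>C\<close> be the component containing \<open>Q\<close> once \<open>P\<close> and its neighbours are removed. The boundary of \<open>C\<close>
then consists of neighbours of \<open>P\<close>, so that all of it is attached to both sides.\<close>

lemma separates_exists:
  assumes "conn_set P" "conn_set Q" "P \<subseteq> V" "Q \<subseteq> V" "anticomplete P Q" "P \<inter> Q = {}"
  obtains X C D where "separates V X C D" "Q \<subseteq> C" "P \<subseteq> D" "\<forall>x\<in>X. \<exists>p\<in>P. E x p"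
proof -
  obtain p q where pq: "p \<in> P" "q \<in> Q" using assms(1,2) by (auto simp: conn_set_def)
  define W where "W = V - P - {v. \<exists>p\<in>P. E p v}"
  have QW: "Q \<subseteq> W" using assms by (auto simp: W_def anticomplete_def)
  define C where "C = component W q"
  define X where "X = {x\<in>V - C. \<exists>c\<in>C. E x c}"
  define D where "D = component (V - X) p"
  have CW: "C \<subseteq> W" "q \<in> C" "conn_set C" using component_sub component_refl component_conn QW pq by (auto simp: C_def)
  have QC: "Q \<subseteq> C" unfolding C_def by (rule component_max[OF assms(2) QW pq(2)]) (use CW C_def in auto)
  have PX: "P \<inter> X = {}" using CW unfolding X_def W_def by (auto dest: adj_sym)
  have PV: "P \<subseteq> V - X" using PX assms by blast
  have PD: "P \<subseteq> D" unfolding D_def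
    by (rule component_max[OF assms(1) PV pq(1)]) (use component_refl PV pq in blast)
  have XN: "\<exists>d\<in>P. E x d" if xX: "x \<in> X" for x
  proof -
    obtain c where c: "c \<in> C" "E x c" "x \<in> V" "x \<notin> C" using xX unfolding X_def by blast
    then have "x \<notin> W" using component_step[of c W q x] adj_sym[of x c] by (auto simp: C_def)
    then show ?thesis using c PX xX unfolding W_def by (auto dest: adj_sym)
  qed
  have CX: "C \<subseteq> V - X" using CW by (auto simp: X_def W_def)
  have C': "C = component (V - X) q"
  proof
    show "C \<subseteq> component (V - X) q"
      by (rule component_max[OF CW(3) CX CW(2)]) (use component_refl CX CW in blast)
    show "component (V - X) q \<subseteq> C"
    proof (rule ccontr)
      assume "\<not> component (V - X) q \<subseteq> C"
      then obtain z where z: "z \<in> component (V - X) q" "z \<notin> C" by blast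
      have "q \<in> V - X" using CX CW by blast
      then have "\<exists>x\<in>C. \<exists>y\<in>component (V - X) q - C. E x y"
        using conn_edge[OF component_conn _ CW(2) z] \<open>C \<subseteq> component (V - X) q\<close> by blast
      then obtain x y where "x \<in> C" "y \<in> V - X" "y \<notin> C" "E x y" using component_sub by blast
      then show False by (auto simp: X_def dest: adj_sym)
    qed
  qed
  have "p \<notin> C" using CW pq by (auto simp: W_def)
  then have "C \<noteq> D" using PD pq by blast
  moreover have "q \<in> V - X" using CX CW by blast
  moreover have "X \<subseteq> V" by (auto simp: X_def)
  moreover have "\<exists>c\<in>C. E x c" if "x \<in> X" for x using that by (simp add: X_def)
  moreover have "\<exists>d\<in>D. E x d" if "x \<in> X" for x using XN[OF that] PD by blast
  moreover have "p \<in> V - X" using PV pq by blast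
  ultimately have "separates V X C D" unfolding separates_def using C' D_def by blast
  then show thesis using that QC PD XN by blast
qed

lemma separatesD:
  assumes "separates V X C D"
  shows "X \<subseteq> V" "C \<subseteq> V - X" "D \<subseteq> V - X" "conn_set C" "conn_set D" "C \<inter> D = {}" "anticomplete C D"
    "\<And>x. x \<in> X \<Longrightarrow> \<exists>c\<in>C. E x c" "\<And>x. x \<in> X \<Longrightarrow> \<exists>d\<in>D. E x d"
proof -
  obtain c where c: "c \<in> V - X" "C = component (V - X) c" using assms unfolding separates_def by blast
  obtain d where d: "d \<in> V - X" "D = component (V - X) d" using assms unfolding separates_def by blast
  have ne: "C \<noteq> D" using assms unfolding separates_def by blast
  show "X \<subseteq> V" using assms unfolding separates_def by blast
  show "\<exists>c\<in>C. E x c" if "x \<in> X" for x using assms that unfolding separates_def by simp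
  show "\<exists>d\<in>D. E x d" if "x \<in> X" for x using assms that unfolding separates_def by simp
  show CV: "C \<subseteq> V - X" unfolding c(2) by (rule component_sub)
  show DV: "D \<subseteq> V - X" unfolding d(2) by (rule component_sub)
  show "conn_set C" unfolding c(2) by (rule component_conn[OF c(1)])
  show "conn_set D" unfolding d(2) by (rule component_conn[OF d(1)])
  show I: "C \<inter> D = {}"
  proof (rule ccontr)
    assume "C \<inter> D \<noteq> {}"
    then obtain z where "z \<in> component (V - X) c" "z \<in> component (V - X) d" unfolding c(2) d(2) by blast
    then show False using component_eq ne unfolding c(2) d(2) by metis
  qed
  show "anticomplete C D" unfolding anticomplete_def
  proof (intro ballI)
    fix a b assume ab: "a \<in> C" "b \<in> D"
    then have "b \<notin> C" "b \<in> V - X" using I DV by auto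
    then show "\<not> E a b" using component_step[of a "V - X" c b] ab(1) unfolding c(2) by blast
  qed
qed

lemma separates_attached:
  assumes s: "separates V X C D" and V: "conn_set V" and u: "u \<in> V - X"
  shows "\<exists>b\<in>component (V - X) u. \<exists>x\<in>X. E x b"
proof -
  note sD = separatesD[OF s]
  have "\<exists>z\<in>V. z \<notin> component (V - X) u"
  proof -
    obtain c d where cd: "c \<in> C" "d \<in> D" using sD(4,5) unfolding conn_set_def by blast
    obtain c0 where c0: "C = component (V - X) c0" using s unfolding separates_def by blast
    have "\<not> (c \<in> component (V - X) u \<and> d \<in> component (V - X) u)"
    proof
      assume cd': "c \<in> component (V - X) u \<and> d \<in> component (V - X) u"
      have "component (V - X) c = component (V - X) u" using component_eq cd' by blast
      moreover have "component (V - X) c = C" using component_eq cd(1) c0 by blast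
      ultimately show False using cd' cd(2) sD(6) by blast
    qed
    then show ?thesis using cd sD(2,3) by blast
  qed
  then obtain z where z: "z \<in> V" "z \<notin> component (V - X) u" by blast
  obtain y t where "y \<in> V" "y \<notin> V - X" "t \<in> component (V - X) u" "E t y"
    using component_bdry[OF V z u] by blast
  then show ?thesis using adj_sym[of t y] by blast
qed

lemma separates_other:
  assumes s: "separates V X C D" and u: "u \<in> V - X"
  obtains D' where "conn_set D'" "D' \<subseteq> V - X" "anticomplete (component (V - X) u) D'" "\<forall>x\<in>X. \<exists>d\<in>D'. E x d"
proof -
  note sD = separatesD[OF s]
  obtain D' where D': "conn_set D'" "D' \<subseteq> V - X" "component (V - X) u \<inter> D' = {}" "\<forall>x\<in>X. \<exists>d\<in>D'. E x d"
  proof (cases "component (V - X) u \<inter> D = {}")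
    case True then show ?thesis using that[of D] sD by blast
  next
    case False
    then obtain z where z: "z \<in> component (V - X) u" "z \<in> D" by blast
    obtain d0 where "D = component (V - X) d0" using s unfolding separates_def by blast
    then have "component (V - X) u = D" using component_eq z by metis
    then show ?thesis using that[of C] sD by blast
  qed
  have "anticomplete (component (V - X) u) D'" unfolding anticomplete_def using D'(2,3) component_step[of _ "V - X" u] by blast
  then show thesis using that D' by blast
qed

end

section \<open>Graphs without an induced five-vertex path\<close>

locale p5_free = sgraph +
  assumes no_P5: "\<lbrakk>E a b; E b c; E c d; E d e; \<not> E a c; \<not> E a d; \<not> E a e; \<not> E b d; \<not> E b e; \<not> E c e\<rbrakk> \<Longrightarrow> False"
begin

lemma attached:
  assumes C: "conn_set C" "c \<in> C" "E x c" and r: "r \<in> C" "\<not> E x r"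
  obtains y t where "y \<in> C" "E x y" "t \<in> component {v\<in>C. \<not> E x v} r" "E y t"
proof -
  have "c \<notin> component {v\<in>C. \<not> E x v} r" using component_sub C(3) by blast
  then obtain y t where "y \<in> C" "y \<notin> {v\<in>C. \<not> E x v}" "t \<in> component {v\<in>C. \<not> E x v} r" "E t y"
    using component_bdry[of C c "{v\<in>C. \<not> E x v}" r] C r by blast
  then show thesis using that[of y t] adj_sym[of t y] by blast
qed

text \<open>The components of the non-neighbours of \<open>x\<close> in \<open>C\<close> are modules as far as the neighbours of \<open>x\<close> in \<open>C\<close>
can see: a vertex \<open>y\<close> mixed on such a component, via an edge \<open>p q\<close>, would give the induced path
\<open>u x y p q\<close>.\<close>

lemma not_mixed:
  assumes ux: "E u x" "\<And>c. c \<in> C \<Longrightarrow> \<not> E u c"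
    and y: "y \<in> C" "E x y" and t: "t \<in> component {v\<in>C. \<not> E x v} r" "E y t"
    and s: "s \<in> component {v\<in>C. \<not> E x v} r"
  shows "E y s"
proof (rule ccontr)
  assume "\<not> E y s"
  have r: "r \<in> {v\<in>C. \<not> E x v}" using t(1) unfolding component_def by blast
  have sub: "component {v\<in>C. \<not> E x v} r \<subseteq> {v\<in>C. \<not> E x v}" by (rule component_sub)
  obtain p q where pq: "p \<in> component {v\<in>C. \<not> E x v} r" "q \<in> component {v\<in>C. \<not> E x v} r" "E y p" "\<not> E y q" "E p q"
    using conn_mixed[OF component_conn[OF r] t s \<open>\<not> E y s\<close>] by blast
  then have "p \<in> C" "q \<in> C" "\<not> E x p" "\<not> E x q" using sub by auto
  then show False using no_P5[of u x y p q] ux y pq by blast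
qed

text \<open>In a connected set with root \<open>v\<close>, the neighbours of \<open>v\<close> form one colour class. A component of the
rest is attached to some neighbour \<open>x\<close> of \<open>v\<close>; its vertices adjacent to \<open>x\<close> are stable, and so are
the others, since by \<open>not_mixed\<close> an edge among them would lie in a triangle.\<close>

theorem triangle_free_colourable: assumes "trifree S" shows "colourable S 3"
proof (rule colourable_comps')
  fix v assume v: "v \<in> S"
  define A where "A = component S v"
  have A: "conn_set A" "v \<in> A" "A \<subseteq> S" using component_conn component_refl component_sub v by (auto simp: A_def)
  have tri: "\<not> (E a b \<and> E b c \<and> E a c)" if "a \<in> A" "b \<in> A" "c \<in> A" for a b c
    using assms A(3) that unfolding trifree_def by blast
  define N where "N = {x\<in>A. E v x}"
  define M where "M = {x\<in>A. \<not> E v x}"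
  have "stable N" unfolding stable_def N_def using tri A(2) by blast
  then have N1: "colourable N 1" by (rule colourable_stable)
  have "colourable M 2"
  proof (rule colourable_comps')
    fix r assume r: "r \<in> M"
    define R where "R = component M r"
    have R: "conn_set R" "r \<in> R" "R \<subseteq> M" using component_conn component_refl component_sub r by (auto simp: R_def)
    show "colourable (component M r) 2"
    proof (cases "v \<in> R")
      case True
      have "w = v" if "w \<in> R" for w
      proof (rule ccontr)
        assume "w \<noteq> v"
        then have "\<exists>x\<in>{v}. \<exists>y\<in>R - {v}. E x y" using conn_edge[OF R(1), of "{v}" v w] True that by auto
        then show False using R(3) unfolding M_def by auto
      qed
      then have "stable R" unfolding stable_def using adj_irrefl by metis
      then show ?thesis using colourable_mono[OF colourable_stable, of R R 2] R_def by simp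
    next
      case False
      obtain x t where xt: "x \<in> A" "x \<notin> M" "t \<in> R" "E t x"
        using component_bdry[of A v M r] A(1,2) False r unfolding R_def M_def by blast
      have x: "E v x" using xt unfolding M_def by blast
      have R': "\<not> E v c" "c \<in> A" if "c \<in> R" for c using R(3) that by (auto simp: M_def)
      have s1: "stable {w\<in>R. E x w}" unfolding stable_def using tri xt(1) R'(2) by blast
      have s2: "stable {w\<in>R. \<not> E x w}" unfolding stable_def
      proof (intro ballI notI)
        fix a b assume ab: "a \<in> {w\<in>R. \<not> E x w}" "b \<in> {w\<in>R. \<not> E x w}" "E a b"
        obtain y z where yz: "y \<in> R" "E x y" "z \<in> component {w\<in>R. \<not> E x w} a" "E y z"
          using attached[OF R(1) xt(3) adj_sym[OF xt(4)]] ab(1) by blast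
        have a': "a \<in> component {w\<in>R. \<not> E x w} a" by (rule component_refl[OF ab(1)])
        have b': "b \<in> component {w\<in>R. \<not> E x w} a" by (rule component_step[OF a' ab(3,2)])
        have "E y a" by (rule not_mixed[OF x R'(1) yz a'])
        moreover have "E y b" by (rule not_mixed[OF x R'(1) yz b'])
        ultimately show False using tri[of y a b] yz(1) ab R'(2) by blast
      qed
      have "R \<subseteq> {w\<in>R. E x w} \<union> {w\<in>R. \<not> E x w}" by blast
      then show ?thesis using colourable_cover[OF colourable_stable[OF s1] colourable_stable[OF s2], of R 2] R_def by simp
    qed
  qed
  moreover have "A \<subseteq> N \<union> M" by (auto simp: N_def M_def)
  ultimately show "colourable (component S v) 3" using colourable_cover[OF N1, of M 2 A 3] A_def by simp
qed

text \<open>The private neighbours \<open>n\<close> of \<open>x\<close> and \<open>r\<close> of \<open>x'\<close> must be adjacent, because otherwise a shortest path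
from \<open>x\<close> to \<open>x'\<close> through \<open>D\<close>, prolonged by \<open>n\<close> and \<open>r\<close>, contains an induced path on five vertices.\<close>

lemma crossing:
  assumes D: "conn_set D" "\<exists>d\<in>D. E x d" "\<exists>d\<in>D. E x' d"
    and C: "\<And>d. d \<in> D \<Longrightarrow> \<not> E n d" "\<And>d. d \<in> D \<Longrightarrow> \<not> E r d"
    and x: "\<not> E x x'" "E n x" "\<not> E n x'" "E r x'" "\<not> E r x"
  shows "E n r"
proof (rule ccontr)
  assume nr: "\<not> E n r"
  define D' where "D' = insert x' D"
  have cD: "conn_set D'" unfolding D'_def using D(1,3) conn_insert by blast
  define N where "N = {p\<in>D. E x p}"
  \<comment> \<open>\<open>Z\<close> collects the vertices at distance at most two from \<open>x\<close> within \<open>D'\<close>; an edge leaving it ends an induced path from \<open>x\<close>.\<close>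
  define Z where "Z = {q\<in>D'. E x q \<or> (\<exists>p\<in>N. E p q)}"
  have x'x: "\<not> E x' x" using x(1) adj_sym by blast
  show False
  proof (cases "\<exists>p\<in>N. E x' p")
    case True
    then obtain p where p: "p \<in> D" "E x p" "E x' p" unfolding N_def by blast
    then show False using no_P5[of n x p x' r] C x nr adj_sym by metis
  next
    case False
    then have "x' \<notin> Z" using x(1) adj_sym unfolding Z_def by blast
    obtain d where d: "d \<in> D" "E x d" using D by blast
    then have "d \<in> Z" unfolding Z_def D'_def by blast
    moreover have "x' \<in> D'" "Z \<subseteq> D'" unfolding D'_def Z_def by auto
    ultimately obtain z w where zw: "z \<in> Z" "w \<in> D'" "w \<notin> Z" "E z w"
      using conn_edge[OF cD, of Z d x'] \<open>x' \<notin> Z\<close> by blast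
    have nw: "\<not> E x w" "\<And>p. p \<in> N \<Longrightarrow> \<not> E p w" using zw unfolding Z_def by auto
    have nz: "\<not> E x z"
    proof
      assume xz: "E x z"
      then have "z \<noteq> x'" using x(1) by blast
      then have "z \<in> N" using xz zw(1) unfolding Z_def N_def D'_def by blast
      then show False using nw zw by blast
    qed
    then obtain p where p: "p \<in> N" "E p z" using zw(1) unfolding Z_def by blast
    have "\<not> E n w" "\<not> E n z" "\<not> E n p" using C zw x p unfolding D'_def N_def Z_def by auto
    then show False using no_P5[of n x p z w] x p nw nz zw unfolding N_def by blast
  qed
qed

text \<open>If \<open>x\<close> were mixed on both \<open>C\<close> and \<open>D\<close>, one edge from either side and \<open>x\<close> in the middle would form an
induced path.\<close>

lemma separates_complete:
  assumes "conn_set C" "conn_set D" "anticomplete C D" "a \<in> C" "E x a" "b \<in> C" "\<not> E x b" "d \<in> D" "E x d" "d' \<in> D"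
  shows "E x d'"
proof (rule ccontr)
  assume "\<not> E x d'"
  then obtain p q where pq: "p \<in> D" "q \<in> D" "E x p" "\<not> E x q" "E p q"
    using conn_mixed[OF assms(2,8,9,10)] by blast
  obtain r s where rs: "r \<in> C" "s \<in> C" "E x r" "\<not> E x s" "E r s"
    using conn_mixed[OF assms(1,4,5,6,7)] by blast
  have "\<not> E s p" "\<not> E s q" "\<not> E r p" "\<not> E r q" using assms(3) pq rs unfolding anticomplete_def by auto
  then show False using no_P5[of s r x p q] pq rs adj_sym by metis
qed

end

section \<open>Stable cutsets in graphs without a four-clique\<close>

locale p5_k4_free = p5_free +
  assumes no_K4: "\<lbrakk>E a b; E a c; E a d; E b c; E b d; E c d\<rbrakk> \<Longrightarrow> False"
begin

lemma trifree_nbhd: "(\<And>v. v \<in> S \<Longrightarrow> E x v) \<Longrightarrow> trifree S"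
  unfolding trifree_def using no_K4 by metis

text \<open>One colour for \<open>X\<close>, the same on all sides of a stable cutset, and four for the rest of \<open>C\<close>. Choose \<open>x\<close>
in \<open>X\<close> so that the set \<open>R x\<close> of non-neighbours of \<open>x\<close> in \<open>C\<close> that are not isolated among the
non-neighbours is smallest. Minimality makes \<open>R x\<close> anticomplete to \<open>X\<close>, so in a 3-colouring of \<open>R x\<close>, one class can
share the colour of \<open>X\<close>, another that of the isolated non-neighbours. The last class together with the
neighbours of \<open>x\<close> in \<open>C\<close> is triangle-free.\<close>

lemma stable_attachment:
  assumes fin: "finite C" and C: "conn_set C" and D: "conn_set D" and CD: "anticomplete C D"
    and X: "stable X" "X \<noteq> {}" and XC: "\<And>x. x \<in> X \<Longrightarrow> \<exists>c\<in>C. E x c" and XD: "\<And>x. x \<in> X \<Longrightarrow> \<exists>d\<in>D. E x d"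
  obtains S where "X \<subseteq> S" "S \<subseteq> X \<union> C" "stable S" "colourable (C - S) 4"
proof -
  define W where "W x = {v\<in>C. \<not> E x v}" for x
  define R where "R x = {r\<in>W x. \<exists>s\<in>W x. E r s}" for x
  have DC: "\<not> E d c \<and> \<not> E c d" if "c \<in> C" "d \<in> D" for c d
    using CD that adj_sym unfolding anticomplete_def by blast
  have full: "E y s" if x: "x \<in> X" and y: "y \<in> C" "E x y" and t: "t \<in> component (W x) r" "E y t" and s: "s \<in> component (W x) r" for x y t r s
  proof -
    obtain d where d: "d \<in> D" "E x d" using XD[OF x] by blast
    show ?thesis using not_mixed[OF adj_sym[OF d(2)], of C y t r s] y t s d DC unfolding W_def by blast
  qed
  have att: "\<exists>y\<in>C. E x y \<and> (\<forall>s\<in>component (W x) r. E y s)" if x: "x \<in> X" and r: "r \<in> W x" for x r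
  proof -
    obtain c where c: "c \<in> C" "E x c" using XC[OF x] by blast
    obtain y t where yt: "y \<in> C" "E x y" "t \<in> component (W x) r" "E y t"
      using attached[OF C c, of r] r unfolding W_def by blast
    then show ?thesis using full[OF x] by blast
  qed
  obtain x where x: "x \<in> X" and xmin: "\<And>x'. x' \<in> X \<Longrightarrow> card (R x) \<le> card (R x')"
  proof -
    obtain x0 where x0: "x0 \<in> X" using X by blast
    show thesis using that ex_has_least_nat[of "\<lambda>x. x \<in> X" x0 "\<lambda>x. card (R x)"] x0 by blast
  qed
  have finR: "finite (R y)" for y using fin unfolding R_def W_def by simp
  have XR: "\<not> E x' r" if x': "x' \<in> X" and r: "r \<in> R x" for x' r
  proof
    assume x'r: "E x' r"
    obtain s where s: "r \<in> W x" "s \<in> W x" "E r s" using r unfolding R_def by blast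
    define K where "K = component (W x) r"
    have K: "conn_set K" "r \<in> K" "s \<in> K" "K \<subseteq> W x"
      using component_conn[OF s(1)] component_refl[OF s(1)] component_step[OF component_refl[OF s(1)] s(3,2)] component_sub unfolding K_def by auto
    have xx': "\<not> E x x'" using X x x' unfolding stable_def by blast
    have x'K: "E x' q" if q: "q \<in> K" for q
    proof (rule ccontr)
      assume n: "\<not> E x' q"
      obtain d where d: "d \<in> D" "E x d" using XD[OF x] by blast
      obtain d' where d': "d' \<in> D" "E x' d'" using XD[OF x'] by blast
      have KD: "anticomplete K D" using CD K(4) unfolding anticomplete_def W_def by blast
      have x'd: "E x' d" by (rule separates_complete[OF K(1) D KD K(2) x'r q n d' d(1)])
      obtain p z where pz: "p \<in> K" "z \<in> K" "E x' p" "\<not> E x' z" "E p z"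
        using conn_mixed[OF K(1,2) x'r q n] by blast
      then have "p \<in> C" "z \<in> C" "\<not> E x p" "\<not> E x z" using K(4) unfolding W_def by auto
      then show False using no_P5[of x d x' p z] d x'd pz xx' DC adj_sym[of x' d] by blast
    qed
    \<comment> \<open>Both ends of an edge within \<open>W x'\<close> lie in \<open>W x\<close>; hence \<open>R x'\<close> is contained in \<open>R x\<close>, and it misses \<open>r\<close>.\<close>
    have key: "\<not> E x w" if w: "w \<in> W x'" and z: "z \<in> W x'" and wz: "E w z" for w z
    proof
      assume xw: "E x w"
      have cr: "E n q" if n: "n \<in> W x'" "E x n" and q: "q \<in> K" for n q
      proof -
        have "n \<in> C" "q \<in> C" "\<not> E x' n" "\<not> E x q" using n q K(4) unfolding W_def by auto
        then show ?thesis
          using crossing[OF D XD[OF x] XD[OF x'], of n q] DC xx' n x'K[OF q] adj_sym by metis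
      qed
      show False
      proof (cases "E x z")
        case True
        then show False using no_K4[of w z r s] cr w z wz xw K(2,3) s(3) by blast
      next
        case False
        have w': "w \<in> component (W x') w" by (rule component_refl[OF w])
        have z': "z \<in> component (W x') w" by (rule component_step[OF w' wz z])
        have "E r w" using cr[OF w xw K(2)] adj_sym by blast
        then have "E r z" using full[OF x' _ x'r w' _ z'] s(1) unfolding W_def by blast
        moreover have "z \<in> W x" using z False unfolding W_def by blast
        ultimately have "z \<in> K" using component_step[of r "W x" r z] K(2) unfolding K_def by blast
        then show False using x'K z unfolding W_def by blast
      qed
    qed
    have "R x' \<subseteq> R x"
    proof
      fix w assume "w \<in> R x'"
      then obtain z where wz: "w \<in> W x'" "z \<in> W x'" "E w z" unfolding R_def by blast
      have "\<not> E x w" "\<not> E x z" using key[OF wz] key[OF wz(2,1) adj_sym[OF wz(3)]] by auto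
      then show "w \<in> R x" using wz unfolding R_def W_def by blast
    qed
    moreover have "r \<notin> R x'" using x'r unfolding R_def W_def by blast
    ultimately have "R x' \<subset> R x" using r by blast
    then have "card (R x') < card (R x)" by (rule psubset_card_mono[OF finR])
    then show False using xmin[OF x'] by simp
  qed
  have comp2: "\<exists>s. E r s \<and> s \<in> W x \<and> (\<forall>y\<in>C. E x y \<longrightarrow> E y r \<longrightarrow> E y s)" if r: "r \<in> R x" for r
  proof -
    obtain s where s: "r \<in> W x" "s \<in> W x" "E r s" using r unfolding R_def by blast
    have "E y s" if "y \<in> C" "E x y" "E y r" for y
      by (rule full[OF x that(1,2) component_refl[OF s(1)] that(3) component_step[OF component_refl[OF s(1)] s(3,2)]])
    then show ?thesis using s by blast
  qed
  have "trifree (R x)" unfolding trifree_def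
  proof (intro ballI notI)
    fix a b c assume abc: "a \<in> R x" "b \<in> R x" "c \<in> R x" "E a b \<and> E b c \<and> E a c"
    then have W: "a \<in> W x" "b \<in> W x" "c \<in> W x" unfolding R_def by auto
    have a: "a \<in> component (W x) a" by (rule component_refl[OF W(1)])
    have b: "b \<in> component (W x) a" using component_step[OF a] abc W by blast
    have c: "c \<in> component (W x) a" using component_step[OF a] abc W by blast
    obtain y where "E y a" "E y b" "E y c" using att[OF x W(1)] a b c by blast
    then show False using no_K4[of y a b c] abc by blast
  qed
  then obtain f :: "'a \<Rightarrow> nat" where f: "\<forall>v\<in>R x. f v < 3" "\<forall>u\<in>R x. \<forall>v\<in>R x. E u v \<longrightarrow> f u \<noteq> f v"
    using triangle_free_colourable unfolding colourable_def by blast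
  define T where "T i = {v\<in>R x. f v = i}" for i
  have T: "stable (T i)" "T i \<subseteq> R x" for i using f(2) unfolding T_def stable_def by fastforce+
  have RT: "R x \<subseteq> T 0 \<union> T 1 \<union> T 2"
  proof
    fix v assume "v \<in> R x"
    moreover have "f v = 0 \<or> f v = 1 \<or> f v = 2" using f(1) calculation by force
    ultimately show "v \<in> T 0 \<union> T 1 \<union> T 2" unfolding T_def by blast
  qed
  define S where "S = X \<union> T 0"
  have S: "stable S" unfolding stable_def
  proof (intro ballI notI)
    fix u v assume uv: "u \<in> S" "v \<in> S" "E u v"
    then have "E v u" using adj_sym by blast
    then show False using uv X(1) T(1)[of 0] T(2)[of 0] XR unfolding S_def stable_def by blast
  qed
  have S2: "stable ((W x - R x) \<union> T 1)" unfolding stable_def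
  proof (intro ballI notI)
    fix u v assume uv: "u \<in> W x - R x \<union> T 1" "v \<in> W x - R x \<union> T 1" "E u v"
    have W: "u \<in> W x" "v \<in> W x" using uv T(2)[of 1] unfolding R_def by auto
    then have "u \<in> R x" "v \<in> R x" using uv(3) adj_sym[OF uv(3)] unfolding R_def by auto
    then have "u \<in> T 1" "v \<in> T 1" using uv by auto
    then show False using T(1)[of 1] uv(3) unfolding stable_def by blast
  qed
  have tri: "trifree ({v\<in>C. E x v} \<union> T 2)"
  proof -
    have r1: False if "r \<in> T 2" "a \<in> {v\<in>C. E x v} \<union> T 2" "b \<in> {v\<in>C. E x v} \<union> T 2" "E a b" "E r a" "E r b" for r a b
    proof -
      have rR: "r \<in> R x" using T(2)[of 2] that(1) by blast
      obtain s where s: "E r s" "\<And>y. y \<in> C \<Longrightarrow> E x y \<Longrightarrow> E y r \<Longrightarrow> E y s" using comp2[OF rR] by blast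
      have "a \<notin> T 2" "b \<notin> T 2" using T(1)[of 2] that unfolding stable_def by auto
      then have "a \<in> C" "E x a" "b \<in> C" "E x b" using that by auto
      moreover have "E a r" "E b r" using that adj_sym by auto
      ultimately have "E a s" "E b s" using s(2) by auto
      then show False using no_K4[of a b r s] that(4) \<open>E a r\<close> \<open>E b r\<close> s(1) by blast
    qed
    show ?thesis unfolding trifree_def
    proof (intro ballI notI)
      fix a b c assume m: "a \<in> {v\<in>C. E x v} \<union> T 2" "b \<in> {v\<in>C. E x v} \<union> T 2" "c \<in> {v\<in>C. E x v} \<union> T 2"
        and e: "E a b \<and> E b c \<and> E a c"
      have e': "E b a" "E c b" "E c a" using e adj_sym by auto
      have "a \<notin> T 2" using r1[of a b c] m e by blast
      moreover have "b \<notin> T 2" using r1[of b a c] m e e' by blast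
      moreover have "c \<notin> T 2" using r1[of c a b] m e e' by blast
      ultimately have "E x a" "E x b" "E x c" using m by auto
      then show False using no_K4[of x a b c] e by blast
    qed
  qed
  have "C - S \<subseteq> ((W x - R x) \<union> T 1) \<union> ({v\<in>C. E x v} \<union> T 2)"
    using RT unfolding S_def W_def by blast
  then have "colourable (C - S) 4" using colourable_cover[OF colourable_stable[OF S2] triangle_free_colourable[OF tri], of "C - S" 4] by simp
  moreover have "S \<subseteq> X \<union> C" using T(2)[of 0] unfolding S_def R_def W_def by blast
  ultimately show thesis using that[of S] S unfolding S_def by blast
qed

text \<open>All components receive the colouring of \<open>stable_attachment\<close>. The stable sets containing parts of \<open>X\<close>
fit together, since distinct components are anticomplete.\<close>

lemma stable_cutset:
  assumes V: "conn_set V" "finite V" and s: "separates V X C D" and X: "stable X"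
  shows "colourable V 5"
proof -
  note sD = separatesD[OF s]
  have ex: "\<exists>S. S \<subseteq> X \<union> B \<and> stable (X \<union> S) \<and> colourable (B - S) 4" if u: "u \<in> V - X" and B: "B = component (V - X) u" for u B
  proof -
    have cB: "conn_set B" "B \<subseteq> V - X" using component_conn[OF u] component_sub B by auto
    define XB where "XB = {x\<in>X. \<exists>b\<in>B. E x b}"
    obtain D' where D': "conn_set D'" "D' \<subseteq> V - X" "anticomplete B D'" "\<forall>x\<in>X. \<exists>d\<in>D'. E x d"
      using separates_other[OF s u] B by blast
    have XB: "XB \<noteq> {}" "stable XB" using separates_attached[OF s V(1) u] B X unfolding XB_def stable_def by auto
    have f: "finite B" using V(2) cB(2) finite_subset by blast
    obtain S where S: "XB \<subseteq> S" "S \<subseteq> XB \<union> B" "stable S" "colourable (B - S) 4"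
      by (rule stable_attachment[OF f cB(1) D'(1,3) XB(2,1)]) (use D'(4) in \<open>auto simp: XB_def\<close>)
    have "stable (X \<union> S)" unfolding stable_def
    proof (intro ballI notI)
      fix p q assume pq: "p \<in> X \<union> S" "q \<in> X \<union> S" "E p q"
      have np: "\<not> E v w" if "v \<in> X" "w \<in> S" for v w
      proof
        assume vw: "E v w"
        have "w \<in> X \<or> w \<in> B" using S(2) that(2) unfolding XB_def by blast
        then show False
        proof
          assume "w \<in> X" then show False using vw X that(1) unfolding stable_def by blast
        next
          assume "w \<in> B" then have "v \<in> XB" using vw that(1) unfolding XB_def by blast
          then show False using S(1,3) that(2) vw unfolding stable_def by blast
        qed
      qed
      show False using np[of p q] np[of q p] pq adj_sym[OF pq(3)] X S(3) unfolding stable_def by blast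
    qed
    then show ?thesis using S unfolding XB_def by blast
  qed
  define f where "f B = (SOME S. S \<subseteq> X \<union> B \<and> stable (X \<union> S) \<and> colourable (B - S) 4)" for B
  have f: "stable (X \<union> f (component (V - X) u))" "colourable (component (V - X) u - f (component (V - X) u)) 4"
    if "u \<in> V - X" for u
    using someI_ex[OF ex[OF that refl]] unfolding f_def by auto
  define T where "T = X \<union> {v\<in>V - X. v \<in> f (component (V - X) v)}"
  have "stable T" unfolding stable_def
  proof (intro ballI notI)
    fix p q assume pq: "p \<in> T" "q \<in> T" "E p q"
    consider "p \<in> X" "q \<in> X" | "p \<in> X" "q \<in> V - X" | "q \<in> X" "p \<in> V - X" | "p \<in> V - X" "q \<in> V - X"
      using pq unfolding T_def by blast
    then show False
    proof cases
      case 1 then show False using X pq unfolding stable_def by blast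
    next
      case 2 then show False using f(1)[of q] pq unfolding T_def stable_def by blast
    next
      case 3 then show False using f(1)[of p] pq unfolding T_def stable_def by blast
    next
      case 4
      have "q \<in> component (V - X) p" by (rule component_step[OF component_refl[OF 4(1)] pq(3) 4(2)])
      then have "component (V - X) q = component (V - X) p" by (rule component_eq)
      then show False using f(1)[of p] pq 4 unfolding T_def stable_def by auto
    qed
  qed
  moreover have "colourable ((V - X) \<inter> (- T)) 4"
  proof (rule colourable_comps)
    fix u assume u: "u \<in> V - X"
    have "component (V - X) u \<inter> - T \<subseteq> component (V - X) u - f (component (V - X) u)"
    proof
      fix v assume v: "v \<in> component (V - X) u \<inter> - T"
      then have "component (V - X) v = component (V - X) u" "v \<in> V - X" using component_eq component_sub by blast+
      then show "v \<in> component (V - X) u - f (component (V - X) u)" using v unfolding T_def by auto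
    qed
    then show "colourable (component (V - X) u \<inter> - T) 4" using colourable_mono[OF f(2)[OF u]] by blast
  qed
  moreover have "V \<subseteq> T \<union> ((V - X) \<inter> (- T))" unfolding T_def by blast
  ultimately show ?thesis using colourable_cover[OF colourable_stable, of T "(V - X) \<inter> (- T)" 4 V 5] by simp
qed

text \<open>Separate the two edges. The vertices of the cutset that are complete to \<open>C\<close> are stable because \<open>C\<close> has
an edge, those mixed on \<open>C\<close> are complete to \<open>D\<close> and stable because \<open>D\<close> has an edge. If one of these
sets is empty, the cutset is stable. If not, the cutset takes two colours, and a component takes three when
one vertex is complete to it; a component without such a vertex has a stable boundary.\<close>

lemma five_colourable_if_2K2:
  assumes V: "conn_set V" "finite V" and ab: "a \<in> V" "b \<in> V" "E a b" and cd: "c \<in> V" "d \<in> V" "E c d"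
    and n: "\<not> E a c" "\<not> E a d" "\<not> E b c" "\<not> E b d"
  shows "colourable V 5"
proof -
  have "a \<noteq> c" "a \<noteq> d" "b \<noteq> c" "b \<noteq> d" using cd(3) adj_sym[OF cd(3)] n by auto
  then have dis: "{a, b} \<inter> {c, d} = {}" by auto
  have ant: "anticomplete {a, b} {c, d}" using n by (simp add: anticomplete_def)
  have sub: "{a, b} \<subseteq> V" "{c, d} \<subseteq> V" using ab cd by auto
  obtain X C D where s: "separates V X C D" and C: "{c, d} \<subseteq> C" and D: "{a, b} \<subseteq> D"
    and "\<forall>x\<in>X. \<exists>p\<in>{a, b}. E x p"
    by (rule separates_exists[OF conn_pair[OF ab(3)] conn_pair[OF cd(3)] sub ant dis])
  note sD = separatesD[OF s]
  define X1 where "X1 = {x\<in>X. \<forall>c\<in>C. E x c}"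
  define X2 where "X2 = {x\<in>X. \<exists>c\<in>C. \<not> E x c}"
  have X: "X = X1 \<union> X2" unfolding X1_def X2_def by blast
  have X2D: "E x d" if "x \<in> X2" "d \<in> D" for x d
    using separates_complete[OF sD(4,5,7)] sD(8,9)[of x] that unfolding X2_def by blast
  have X1: "stable X1" unfolding stable_def X1_def using no_K4[of _ _ c d] C cd by blast
  have X2: "stable X2" unfolding stable_def using no_K4[of _ _ a b] D ab X2D by blast
  show ?thesis
  proof (cases "X1 = {} \<or> X2 = {}")
    case True
    then have "stable X" using X X1 X2 by auto
    then show ?thesis by (rule stable_cutset[OF V s])
  next
    case False
    then obtain x1 x2 where x12: "x1 \<in> X1" "x2 \<in> X2" by blast
    show ?thesis
    proof (cases "\<exists>u\<in>V - X. u \<notin> C \<and> (\<forall>x\<in>X2. \<forall>b\<in>component (V - X) u. \<not> E x b)")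
      case True
      then obtain u where u: "u \<in> V - X" "u \<notin> C" "\<And>x b. x \<in> X2 \<Longrightarrow> b \<in> component (V - X) u \<Longrightarrow> \<not> E x b" by blast
      define B where "B = component (V - X) u"
      have B: "conn_set B" "B \<subseteq> V - X" "u \<in> B" using component_conn[OF u(1)] component_sub component_refl[OF u(1)] B_def by auto
      obtain c0 where c0: "C = component (V - X) c0" using s unfolding separates_def by blast
      have BC: "B \<inter> C = {}"
      proof (rule ccontr)
        assume "B \<inter> C \<noteq> {}"
        then obtain z where "z \<in> B" "z \<in> C" by blast
        then have "B = C" using component_eq c0 B_def by metis
        then show False using u(2) B(3) by blast
      qed
      have ac: "anticomplete B C" unfolding anticomplete_def
        using BC sD(2) component_step[of _ "V - X" u] B_def by blast
      have BV: "B \<subseteq> V" and CV: "C \<subseteq> V" using B(2) sD(2) by auto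
      obtain X' B' C' where s': "separates V X' C' B'" and BB: "B \<subseteq> B'" "C \<subseteq> C'"
          and XN: "\<forall>x\<in>X'. \<exists>p\<in>B. E x p"
        by (rule separates_exists[OF B(1) sD(4) BV CV ac BC])
      note sD' = separatesD[OF s']
      \<comment> \<open>Every vertex of \<open>X'\<close> has a neighbour in \<open>B\<close>, and no vertex of \<open>X2\<close> does.\<close>
      have "X' \<subseteq> X1"
      proof
        fix x assume x: "x \<in> X'"
        obtain p where p: "p \<in> B" "E x p" using XN x by blast
        have xV: "x \<in> V" "x \<notin> B" using sD'(1,3) BB x by auto
        have "x \<notin> V - X" using component_step[of p "V - X" u x] p adj_sym[OF p(2)] xV B_def by blast
        then show "x \<in> X1" using u(3)[of x p] p xV X B_def by blast
      qed
      then have "stable X'" using X1 stable_mono by blast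
      then show ?thesis by (rule stable_cutset[OF V s'])
    next
      case False
      have "colourable (V - X) 3"
      proof (rule colourable_comps')
        fix u assume u: "u \<in> V - X"
        define B where "B = component (V - X) u"
        have B: "conn_set B" "B \<subseteq> V - X" "u \<in> B" using component_conn[OF u] component_sub component_refl[OF u] B_def by auto
        have "trifree B"
        proof (cases "u \<in> C")
          case True
          obtain c0 where c0: "C = component (V - X) c0" using s unfolding separates_def by blast
          then have "B = C" using True component_eq B_def by metis
          then show ?thesis using trifree_nbhd[of C x1] x12 unfolding X1_def by blast
        next
          case uC: False
          then obtain x b where x: "x \<in> X2" "b \<in> B" "E x b" using False u B_def by blast
          obtain p where p: "p \<in> C" "\<not> E x p" using x unfolding X2_def by blast
          obtain q where q: "q \<in> C" "E x q" using sD(8)[of x] x X by blast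
          have "anticomplete C B" unfolding anticomplete_def
          proof (intro ballI notI)
            fix g h assume gh: "g \<in> C" "h \<in> B" "E g h"
            then have "g \<in> B" using component_step[of h "V - X" u g] adj_sym sD(2) B_def by blast
            obtain c0 where c0: "C = component (V - X) c0" using s unfolding separates_def by blast
            then have "B = C" using \<open>g \<in> B\<close> gh(1) component_eq B_def by metis
            then show False using uC B(3) by blast
          qed
          then have "E x v" if "v \<in> B" for v
            using separates_complete[OF sD(4) B(1) _ q p x(2,3) that] by blast
          then show ?thesis by (rule trifree_nbhd)
        qed
        then show "colourable (component (V - X) u) 3" using triangle_free_colourable B_def by blast
      qed
      moreover have "colourable X 2" using colourable_cover[OF colourable_stable[OF X1] colourable_stable[OF X2], of X 2] X by simp
      moreover have "V \<subseteq> (V - X) \<union> X" by blast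
      ultimately show ?thesis using colourable_cover[of "V - X" 3 X 2 V 5] by simp
    qed
  qed
qed

end

section \<open>Graphs with neither two independent edges nor a four-clique\<close>

locale two_K2_k4_free = p5_k4_free +
  assumes no_2K2: "\<lbrakk>E a b; E c d\<rbrakk> \<Longrightarrow> E a c \<or> E a d \<or> E b c \<or> E b d"
begin

text \<open>The obstruction to using \<open>a\<close> and \<open>b\<close> in one colour class: an edge \<open>t t'\<close> among the
non-neighbours of \<open>d\<close> whose ends tell \<open>a\<close> and \<open>b\<close> apart.\<close>

definition splits :: "'a \<Rightarrow> 'a \<Rightarrow> 'a \<Rightarrow> 'a \<Rightarrow> 'a \<Rightarrow> bool" where
  "splits d a b t t' \<longleftrightarrow> \<not> E d t \<and> \<not> E d t' \<and> E t t' \<and> E t a \<and> \<not> E t b \<and> E t' b \<and> \<not> E t' a"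

text \<open>A five-cycle \<open>c0 c1 c2 c3 c4\<close> in the neighbourhood of \<open>d\<close> in which \<open>c0\<close> is doubled to \<open>a\<close>, \<open>b\<close> and
\<open>c2\<close> to \<open>e\<close>, \<open>f\<close>. The symmetries \<open>frame_mirror\<close> and \<open>frame_swap\<close> halve the case analyses below.\<close>

definition frame :: "'a \<Rightarrow> 'a \<Rightarrow> 'a \<Rightarrow> 'a \<Rightarrow> 'a \<Rightarrow> 'a \<Rightarrow> 'a \<Rightarrow> 'a \<Rightarrow> bool" where
  "frame d a b c1 e f c3 c4 \<longleftrightarrow>
     E d a \<and> E d b \<and> E d c1 \<and> E d e \<and> E d f \<and> E d c3 \<and> E d c4 \<and>
     E a c1 \<and> E b c1 \<and> E a c4 \<and> E b c4 \<and> E e c1 \<and> E f c1 \<and> E e c3 \<and> E f c3 \<and> E c3 c4 \<and>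
     \<not> E a e \<and> \<not> E a f \<and> \<not> E b e \<and> \<not> E b f \<and> \<not> E a c3 \<and> \<not> E b c3 \<and> \<not> E e c4 \<and> \<not> E f c4 \<and>
     \<not> E c1 c3 \<and> \<not> E c1 c4"

lemma frame_mirror: "frame d a b c1 e f c3 c4 \<Longrightarrow> frame d e f c1 a b c4 c3"
  unfolding frame_def using adj_sym by metis

lemma frame_swap: "frame d a b c1 e f c3 c4 \<Longrightarrow> frame d b a c1 e f c3 c4"
  unfolding frame_def by blast

lemma splits_swap: "splits d a b t t' \<Longrightarrow> splits d b a t' t"
  unfolding splits_def using adj_sym by blast

lemma split_near:
  assumes F: "frame d a b c1 e f c3 c4" and s: "splits d a b t t'"
  shows "E t e \<or> E t f \<Longrightarrow> E t c4" "E t c3 \<Longrightarrow> E t c1" "\<not> E t c3 \<Longrightarrow> E t e \<and> E t f"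
proof -
  have F': "E b c1" "E b c4" "E a c1" "E e c3" "E f c3" "\<not> E b e" "\<not> E b f" "\<not> E b c3" "\<not> E a e" "\<not> E a f"
    "\<not> E a c3" "\<not> E c4 e" "\<not> E c4 f" "\<not> E c1 c3" "E a t" "\<not> E b t"
    using F s adj_sym unfolding frame_def splits_def by metis+
  show "E t c4" if "E t e \<or> E t f"
    using no_2K2[of b c4 t e] no_2K2[of b c4 t f] F' that adj_sym[of c4 t] by blast
  show "E t c1" if "E t c3" using no_2K2[of b c1 t c3] F' that adj_sym[of c1 t] by blast
  show "E t e \<and> E t f" if "\<not> E t c3"
    using no_2K2[of a t e c3] no_2K2[of a t f c3] F' that by blast
qed

lemma split_full:
  assumes F: "frame d a b c1 e f c3 c4" and s: "splits d a b t t'"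
  shows "(E t e \<and> E t f) \<or> (E t' e \<and> E t' f)"
proof -
  note 1 = split_near[OF F s] and 2 = split_near[OF frame_swap[OF F] splits_swap[OF s]]
  have cov: "E t x \<or> E t' x" if "E d x" for x
    using no_2K2[of d x t t'] that s adj_sym[of x] unfolding splits_def by blast
  have "\<not> (E t c3 \<and> E t' c3 \<and> E t c4 \<and> E t' c4)"
    using no_K4[of t t' c3 c4] F s unfolding frame_def splits_def by blast
  moreover have "E t e \<or> E t' e" "E t f \<or> E t' f" using cov F unfolding frame_def by auto
  ultimately show ?thesis using 1 2 by blast
qed

text \<open>The heart of the case in which any two edges touch. The two splitting edges, together with the frame,
force one adjacency after another, by the two excluded subgraphs in turn, until the edges \<open>b s'\<close> and \<open>e t\<close>
have nothing between them.\<close>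

lemma splits_incompatible_aux:
  assumes F: "frame d a b c1 e f c3 c4" and t: "splits d a b t t'" and s: "splits d e f s s'"
    and te: "E t e" "E t f" and sa: "E s a" "E s b" and c: "E t c1" "\<not> E s c1"
  shows False
proof -
  note F' = F[unfolded frame_def] and t' = t[unfolded splits_def] and s' = s[unfolded splits_def]
  note M = frame_mirror[OF F]
  have cov: "E p x \<or> E q x" if "E d x" "E p q" "\<not> E d p" "\<not> E d q" for x p q
    using no_2K2[of d x p q] that adj_sym[of x] by blast
  have ts: "E t s" using no_2K2[of b s f t] F' t' s' te sa adj_sym by metis
  have "E t c4" using split_near(1)[OF F t] te by blast
  have "E s c3" using split_near(1)[OF M s] sa by blast
  have "\<not> E s c4" using no_K4[of a c4 t s] F' t' sa ts \<open>E t c4\<close> adj_sym by metis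
  have "\<not> E t c3" using no_K4[of e c3 t s] F' s' te ts \<open>E s c3\<close> adj_sym by metis
  have "E t' c3" using cov[of c3 t t'] \<open>\<not> E t c3\<close> F' t' by blast
  then have "E t' c1" using split_near(2)[OF frame_swap[OF F] splits_swap[OF t]] by blast
  have "E s' c4" using cov[of c4 s s'] \<open>\<not> E s c4\<close> F' s' by blast
  then have "E s' c1" using split_near(2)[OF frame_swap[OF M] splits_swap[OF s]] by blast
  have t'e: "\<not> E t' e" using no_K4[of c1 e t t'] F' t' te c(1) \<open>E t' c1\<close> adj_sym by metis
  have t'f: "\<not> E t' f" using no_K4[of c1 f t t'] F' t' te c(1) \<open>E t' c1\<close> adj_sym by metis
  have "\<not> E t' s'" using cov[of e t' s'] t'e F' t' s' by blast
  have "E b s'" using no_2K2[of b t' f s'] F' t' s' t'f \<open>\<not> E t' s'\<close> adj_sym by metis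
  have "\<not> E s' t" using no_K4[of c1 f t s'] F' s' te c(1) \<open>E s' c1\<close> adj_sym by metis
  then show False using no_2K2[of b s' e t] \<open>E b s'\<close> F' t' s' te adj_sym by metis
qed

lemma splits_incompatible:
  assumes F: "frame d a b c1 e f c3 c4" and t: "splits d a b t t'" and s: "splits d e f s s'"
  shows False
proof -
  have main: False if F: "frame d a b c1 e f c3 c4" and t: "splits d a b t t'" and s: "splits d e f s s'"
    and te: "E t e" "E t f" and sa: "E s a" "E s b" for a b e f t t' s s'
  proof -
    note F' = F[unfolded frame_def] and t' = t[unfolded splits_def] and s' = s[unfolded splits_def]
    have ts: "E t s" using no_2K2[of b s f t] F' t' s' te sa adj_sym by metis
    have "E t c1 \<or> E s c1" using no_2K2[of d c1 t s] ts F' t' s' adj_sym[of c1] by blast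
    moreover have "\<not> (E t c1 \<and> E s c1)" using no_K4[of a c1 t s] F' t' sa ts adj_sym by metis
    ultimately show False
      using splits_incompatible_aux[OF F t s te sa] splits_incompatible_aux[OF frame_mirror[OF F] s t sa te] by blast
  qed
  have F2: "frame d b a c1 e f c3 c4" "frame d a b c1 f e c3 c4" "frame d b a c1 f e c3 c4"
    using frame_swap[OF F] frame_mirror[OF frame_swap[OF frame_mirror[OF F]]]
      frame_mirror[OF frame_swap[OF frame_mirror[OF frame_swap[OF F]]]] by auto
  note t2 = splits_swap[OF t] and s2 = splits_swap[OF s]
  have "(E t e \<and> E t f) \<or> (E t' e \<and> E t' f)" by (rule split_full[OF F t])
  moreover have "(E s a \<and> E s b) \<or> (E s' a \<and> E s' b)" by (rule split_full[OF frame_mirror[OF F] s])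
  ultimately show False
    using main[OF F t s] main[OF F2(1) t2 s] main[OF F2(2) t s2] main[OF F2(3) t2 s2] by blast
qed

definition C5 :: "'a \<Rightarrow> 'a \<Rightarrow> 'a \<Rightarrow> 'a \<Rightarrow> 'a \<Rightarrow> 'a \<Rightarrow> bool" where
  "C5 d c0 c1 c2 c3 c4 \<longleftrightarrow> E d c0 \<and> E d c1 \<and> E d c2 \<and> E d c3 \<and> E d c4 \<and>
     E c0 c1 \<and> E c1 c2 \<and> E c2 c3 \<and> E c3 c4 \<and> E c4 c0 \<and>
     \<not> E c0 c2 \<and> \<not> E c1 c3 \<and> \<not> E c2 c4 \<and> \<not> E c3 c0 \<and> \<not> E c4 c1"

text \<open>Let \<open>Y\<close> be the set of neighbours of \<open>d\<close> that are attached to the cycle like \<open>c0\<close>. The remaining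
neighbours of \<open>d\<close> are bipartite. The non-neighbours of \<open>d\<close> without a neighbour in \<open>Y\<close> join the colour of
\<open>Y\<close>. Those with a neighbour in \<open>Y\<close> are divided by adjacency to \<open>c1\<close>, which is complete to \<open>Y\<close>: an edge
between two that are adjacent to \<open>c1\<close> has no common neighbour in \<open>Y\<close>, so it splits two elements of \<open>Y\<close>.\<close>

lemma five_colourable_unsplit:
  assumes C: "C5 d c0 c1 c2 c3 c4"
    and ns: "\<And>a b t t'. \<lbrakk>E d a; E d b; E a c1; E b c1; E a c4; E b c4\<rbrakk> \<Longrightarrow> \<not> splits d a b t t'"
  shows "colourable UNIV 5"
proof -
  note C' = C[unfolded C5_def]
  define Y where "Y = {x. E d x \<and> E x c1 \<and> E x c4}"
  have tri: "\<not> (E d x \<and> E d y \<and> E d z \<and> E x y \<and> E y z \<and> E x z)" for x y z using no_K4 by blast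
  have c0: "c0 \<in> Y" using C' adj_sym unfolding Y_def by blast
  have st: "stable {t. \<not> E d t \<and> \<not> E x t}" if "E d x" for x
    unfolding stable_def using no_2K2[OF that] by blast
  have X1: "stable {x. E d x \<and> E x c2}" unfolding stable_def using no_K4[of d _ _ c2] C' by blast
  have X2: "stable {x. E d x \<and> \<not> E x c2 \<and> x \<notin> Y}" unfolding stable_def
  proof (intro ballI notI)
    fix x y assume x: "x \<in> {x. E d x \<and> \<not> E x c2 \<and> x \<notin> Y}" and y: "y \<in> {x. E d x \<and> \<not> E x c2 \<and> x \<notin> Y}" and xy: "E x y"
    have hit: "\<lbrakk>E p q; \<not> E u p; \<not> E u q; E u v\<rbrakk> \<Longrightarrow> E v p \<or> E v q" for p q u v
      using no_2K2[of u v p q] by blast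
    have one: False if u: "E d u" "\<not> E u c2" and v: "E d v" "\<not> E v c2" and uv: "E u v" "E u c1" "E u c3" for u v
    proof -
      have "\<not> E v c1" "\<not> E v c3" using tri[of u v c1] tri[of u v c3] u v uv C' by blast+
      moreover have "\<not> E u c0" "\<not> E u c4" using tri[of u c0 c1] tri[of u c3 c4] u uv C' by blast+
      ultimately have "E v c0 \<or> E v c4" using hit[of c4 c0 u v] C' uv by blast
      then show False using no_2K2[of v c0 c2 c3] no_2K2[of v c4 c1 c2] v \<open>\<not> E v c1\<close> \<open>\<not> E v c3\<close> C' adj_sym by metis
    qed
    have two: False if u: "E d u" "u \<notin> Y" "\<not> E u c3" and uv: "E u c1" for u
      using no_2K2[of u c1 c3 c4] u uv C' adj_sym unfolding Y_def by blast
    have xyd: "E d x" "E d y" "\<not> E x c2" "\<not> E y c2" "x \<notin> Y" "y \<notin> Y" using x y by auto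
    have "E x c1 \<or> E y c1" using no_2K2[of x y c1 c2] xy C' xyd by blast
    moreover have "E x c3 \<or> E y c3" using no_2K2[of x y c2 c3] xy C' xyd by blast
    ultimately show False
      using one[of x y] one[of y x] two[of x] two[of y] xyd xy adj_sym[OF xy] by blast
  qed
  have Z1: "stable (Y \<union> {t. \<not> E d t \<and> (\<forall>y\<in>Y. \<not> E y t)})" unfolding stable_def
  proof (intro ballI notI)
    fix u v assume u: "u \<in> Y \<union> {t. \<not> E d t \<and> (\<forall>y\<in>Y. \<not> E y t)}" and v: "v \<in> Y \<union> {t. \<not> E d t \<and> (\<forall>y\<in>Y. \<not> E y t)}" and uv: "E u v"
    have vu: "E v u" using uv adj_sym by blast
    consider "u \<in> Y" "v \<in> Y" | "u \<in> Y" "v \<notin> Y" | "u \<notin> Y" "v \<in> Y" | "u \<notin> Y" "v \<notin> Y" by blast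
    then show False
    proof cases
      case 1 then show False using no_K4[of d u v c1] C' uv unfolding Y_def by blast
    next
      case 2 then show False using v uv by blast
    next
      case 3 then show False using u vu by blast
    next
      case 4
      then have "\<not> E d u" "\<not> E d v" "\<not> E c0 u" "\<not> E c0 v" using u v c0 by auto
      then show False using st[of c0] uv C' unfolding stable_def by blast
    qed
  qed
  have Z2: "stable {t. \<not> E d t \<and> \<not> E c1 t}" using st C' by blast
  have Z3: "stable {t. \<not> E d t \<and> E c1 t \<and> (\<exists>y\<in>Y. E y t)}" unfolding stable_def
  proof (intro ballI notI)
    fix u v assume u: "u \<in> {t. \<not> E d t \<and> E c1 t \<and> (\<exists>y\<in>Y. E y t)}" and v: "v \<in> {t. \<not> E d t \<and> E c1 t \<and> (\<exists>y\<in>Y. E y t)}" and uv: "E u v"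
    obtain y z where yz: "y \<in> Y" "z \<in> Y" "E y u" "E z v" using u v by blast
    have no: "\<not> (E w u \<and> E w v)" if "w \<in> Y" for w
      using no_K4[of w c1 u v] that u v uv unfolding Y_def by blast
    have "splits d y z u v" unfolding splits_def
      using no[OF yz(1)] no[OF yz(2)] yz uv u v adj_sym by blast
    then show False using ns[of y z u v] yz unfolding Y_def by blast
  qed
  have "colourable ({x. E d x \<and> E x c2} \<union> {x. E d x \<and> \<not> E x c2 \<and> x \<notin> Y}) (1 + 1)"
    by (intro colourable_Un colourable_stable X1 X2)
  then have "colourable (({x. E d x \<and> E x c2} \<union> {x. E d x \<and> \<not> E x c2 \<and> x \<notin> Y}) \<union>
     ((Y \<union> {t. \<not> E d t \<and> (\<forall>y\<in>Y. \<not> E y t)}) \<union> ({t. \<not> E d t \<and> \<not> E c1 t} \<union> {t. \<not> E d t \<and> E c1 t \<and> (\<exists>y\<in>Y. E y t)})))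
     (1 + 1 + (1 + (1 + 1)))"
    by (intro colourable_Un[of "{x. E d x \<and> E x c2} \<union> {x. E d x \<and> \<not> E x c2 \<and> x \<notin> Y}"] colourable_Un[OF colourable_stable[OF Z1]] colourable_Un[OF colourable_stable[OF Z2]] colourable_stable[OF Z3])
  then show ?thesis by (rule colourable_mono) auto
qed

text \<open>A bipartite neighbourhood of \<open>d\<close> is easy; a triangle-free neighbourhood in which all edges touch is
bipartite unless it contains a five-cycle \<open>u v r w p\<close>. By \<open>splits_incompatible\<close>, splitting cannot
occur both at \<open>u\<close> and at \<open>r\<close>, so \<open>five_colourable_unsplit\<close> applies to one of them.\<close>

theorem five_colourable: "colourable UNIV 5"
proof (cases "\<exists>d x. E d x")
  case False
  then show ?thesis using colourable_mono[OF colourable_stable, of UNIV UNIV 5] unfolding stable_def by auto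
next
  case True
  then obtain d x0 where d: "E d x0" by blast
  define X where "X = {x. E d x}"
  have st: "stable {t. \<not> E d t \<and> \<not> E x t}" if "E d x" for x
    unfolding stable_def using no_2K2[OF that] by blast
  have tri: "\<not> (x \<in> X \<and> y \<in> X \<and> z \<in> X \<and> E x y \<and> E y z \<and> E x z)" for x y z using no_K4 unfolding X_def by blast
  show ?thesis
  proof (cases "stable X")
    case True
    have "trifree {t. \<not> E d t \<and> E x0 t}" by (rule trifree_nbhd) auto
    then have "colourable ({t. \<not> E d t \<and> E x0 t} \<union> ({t. \<not> E d t \<and> \<not> E x0 t} \<union> X)) (3 + (1 + 1))"
      by (intro colourable_Un triangle_free_colourable colourable_stable st[OF d] True)
    then show ?thesis by (rule colourable_mono) (auto simp: X_def)
  next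
    case False
    then obtain u v where uv: "u \<in> X" "v \<in> X" "E u v" unfolding stable_def by blast
    show ?thesis
    proof (cases "\<exists>o1\<in>X. \<exists>p\<in>X. \<exists>r\<in>X. \<not> E o1 u \<and> \<not> E o1 v \<and> E o1 p \<and> E p u \<and> E o1 r \<and> E r v")
      case True
      then obtain w p r where w: "w \<in> X" "p \<in> X" "r \<in> X" "\<not> E w u" "\<not> E w v" "E w p" "E p u" "E w r" "E r v" by blast
      have "\<not> E p v" "\<not> E r u" "\<not> E r p"
        using tri[of p u v] tri[of r v u] tri[of w r p] w uv adj_sym[OF uv(3)] by auto
      then have C: "C5 d u v r w p" unfolding C5_def using w uv adj_sym unfolding X_def by blast
      then have C': "C5 d r v u p w" unfolding C5_def using adj_sym by blast
      show ?thesis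
      proof (cases "\<exists>a b t t'. E d a \<and> E d b \<and> E a v \<and> E b v \<and> E a p \<and> E b p \<and> splits d a b t t'")
        case False
        then show ?thesis using five_colourable_unsplit[OF C] by blast
      next
        case True
        then obtain a b t t' where ab: "E d a" "E d b" "E a v" "E b v" "E a p" "E b p" "splits d a b t t'" by blast
        have "\<not> splits d e f s s'" if ef: "E d e" "E d f" "E e v" "E f v" "E e w" "E f w" for e f s s'
        proof
          assume s: "splits d e f s s'"
          have n: "\<not> E x y" if "E d x" "E d y" "E d z" "E x z" "E y z" for x y z
            using no_K4[of d x y z] that by blast
          have "frame d a b v e f w p" unfolding frame_def
            using ab ef C[unfolded C5_def] n[of a e v] n[of a f v] n[of b e v] n[of b f v]
              n[of a w p] n[of b w p] n[of e p w] n[of f p w] adj_sym by metis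
          then show False using splits_incompatible ab(7) s by blast
        qed
        then show ?thesis using five_colourable_unsplit[OF C'] by blast
      qed
    next
      case no: False
      \<comment> \<open>A bipartition of \<open>X\<close>: vertices adjacent to neither end of \<open>u v\<close> have neighbours on one side only.\<close>
      define P where "P = {x\<in>X. E x u \<or> \<not> E x v \<and> \<not> (\<exists>p\<in>X. E p u \<and> E x p)}"
      have oo: "\<not> E x y" if "\<not> E x u" "\<not> E x v" "\<not> E y u" "\<not> E y v" for x y
        using no_2K2[of x y u v] that uv(3) by blast
      have P: "stable P" unfolding stable_def
      proof (intro ballI notI)
        fix x y assume x: "x \<in> P" and y: "y \<in> P" and xy: "E x y"
        then show False using tri[of x y u] oo[of x y] uv(1) adj_sym[OF xy] unfolding P_def by blast
      qed
      have Q: "stable (X - P)" unfolding stable_def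
      proof (intro ballI notI)
        fix x y assume x: "x \<in> X - P" and y: "y \<in> X - P" and xy: "E x y"
        have xx: "x \<in> X" "\<not> E x u" "E x v \<or> (\<exists>p\<in>X. E p u \<and> E x p)" using x unfolding P_def by auto
        have yy: "y \<in> X" "\<not> E y u" "E y v \<or> (\<exists>p\<in>X. E p u \<and> E y p)" using y unfolding P_def by auto
        show False
          using tri[of x y v] oo[of x y] uv xx yy xy adj_sym[OF xy] no by blast
      qed
      have M: "stable {t. \<not> E d t \<and> E u t \<and> E v t}" unfolding stable_def using no_K4[OF uv(3)] by blast
      have M2: "stable {t. \<not> E d t \<and> E u t \<and> \<not> E v t}"
        by (rule stable_mono[OF st[of v]]) (use uv in \<open>auto simp: X_def\<close>)
      have M1: "stable {t. \<not> E d t \<and> \<not> E u t}" by (rule st) (use uv in \<open>auto simp: X_def\<close>)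
      have "colourable (P \<union> ((X - P) \<union> ({t. \<not> E d t \<and> E u t \<and> E v t} \<union> ({t. \<not> E d t \<and> E u t \<and> \<not> E v t} \<union> {t. \<not> E d t \<and> \<not> E u t})))) (1 + (1 + (1 + (1 + 1))))"
        by (intro colourable_Un colourable_stable P Q M M1 M2)
      then show ?thesis by (rule colourable_mono) (auto simp: X_def)
    qed
  qed
qed

end

section \<open>Five colours for clique number three\<close>

context sgraph
begin

lemma trifree_if_clique_le: "clique_le S 2 \<Longrightarrow> trifree S"
  unfolding trifree_def
proof (intro ballI notI)
  fix a b c assume S: "clique_le S 2" "a \<in> S" "b \<in> S" "c \<in> S" "E a b \<and> E b c \<and> E a c"
  then have "a \<noteq> b" "b \<noteq> c" "a \<noteq> c" using adj_irrefl by auto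
  then have "card {a, b, c} = 3" by simp
  moreover have "is_clique {a, b, c}" using S(5) adj_sym unfolding is_clique_def by blast
  moreover have "{a, b, c} \<subseteq> S" using S by blast
  ultimately have "3 \<le> (2::nat)" using S(1) unfolding clique_le_def by metis
  then show False by simp
qed

end

context p5_free
begin

text \<open>The lemmas \<open>five_colourable_if_2K2\<close> and \<open>five_colourable\<close> are about relations without a four-clique
anywhere, so they are applied to \<open>E\<close> restricted to \<open>A\<close>.\<close>

lemma five_colourable_if_conn:
  assumes A: "conn_set A" "finite A" "clique_le A 3"
  shows "colourable A 5"
proof -
  define E' where "E' x y \<longleftrightarrow> E x y \<and> x \<in> A \<and> y \<in> A" for x y
  interpret H: p5_k4_free E'
  proof
    show "E' y x" if "E' x y" for x y using that adj_sym unfolding E'_def by blast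
    show "\<not> E' x x" for x using adj_irrefl unfolding E'_def by blast
    show False if "E' a b" "E' b c" "E' c d" "E' d e" "\<not> E' a c" "\<not> E' a d" "\<not> E' a e" "\<not> E' b d" "\<not> E' b e" "\<not> E' c e" for a b c d e
      using no_P5[of a b c d e] that unfolding E'_def by blast
    show False if e: "E' a b" "E' a c" "E' a d" "E' b c" "E' b d" "E' c d" for a b c d
    proof -
      have m: "a \<in> A" "b \<in> A" "c \<in> A" "d \<in> A" and e': "E a b" "E a c" "E a d" "E b c" "E b d" "E c d"
        using e unfolding E'_def by auto
      have "a \<noteq> b" "a \<noteq> c" "a \<noteq> d" "b \<noteq> c" "b \<noteq> d" "c \<noteq> d" using e' adj_irrefl by auto
      then have "card {a, b, c, d} = 4" by simp
      moreover have "is_clique {a, b, c, d}" using e' e'[THEN adj_sym] unfolding is_clique_def by blast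
      moreover have "{a, b, c, d} \<subseteq> A" using m by blast
      ultimately have "4 \<le> (3::nat)" using A(3) unfolding clique_le_def by metis
      then show False by simp
    qed
  qed
  have "H.colourable A 5"
  proof (cases "\<exists>a b c d. E' a b \<and> E' c d \<and> \<not> E' a c \<and> \<not> E' a d \<and> \<not> E' b c \<and> \<not> E' b d")
    case True
    then obtain a b c d where e: "E' a b" "E' c d" "\<not> E' a c" "\<not> E' a d" "\<not> E' b c" "\<not> E' b d" by blast
    then have m: "a \<in> A" "b \<in> A" "c \<in> A" "d \<in> A" unfolding E'_def by auto
    have "\<exists>x\<in>B. \<exists>y\<in>A - B. E' x y" if B: "B \<subseteq> A" "B \<noteq> {}" "B \<noteq> A" for B
    proof -
      obtain x y where "x \<in> B" "y \<in> A - B" "E x y" using A(1) B unfolding conn_set_def by blast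
      then show ?thesis using B(1) unfolding E'_def by blast
    qed
    moreover have "A \<noteq> {}" using m by blast
    ultimately have "H.conn_set A" unfolding H.conn_set_def by blast
    then show ?thesis using H.five_colourable_if_2K2[OF _ A(2) m(1,2) e(1) m(3,4) e(2-6)] by blast
  next
    case False
    interpret H2: two_K2_k4_free E' by unfold_locales (use False in blast)
    show ?thesis by (rule H.colourable_mono[OF H2.five_colourable]) auto
  qed
  then show ?thesis unfolding H.colourable_def colourable_def E'_def by blast
qed

end

section \<open>The recursion on the clique number\<close>

context sgraph
begin

text \<open>Where the halving of the clique number comes from: applied to a clique with \<open>w div 2 + 1\<close> elements.\<close>

lemma clique_le_join:
  assumes T: "finite T" "clique_le T w" and K: "K \<subseteq> T" "is_clique K" and S: "S \<subseteq> T" "\<And>s k. s \<in> S \<Longrightarrow> k \<in> K \<Longrightarrow> E s k"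
  shows "clique_le S (w - card K)"
  unfolding clique_le_def
proof (intro allI impI)
  fix L assume L: "L \<subseteq> S" "is_clique L"
  have LK: "E l k \<and> E k l" if "l \<in> L" "k \<in> K" for l k using S(2)[of l k] L(1) that adj_sym by blast
  have c: "is_clique (K \<union> L)" using K(2) L(2) LK unfolding is_clique_def by blast
  have "K \<union> L \<subseteq> T" using K(1) L(1) S(1) by blast
  then have "card (K \<union> L) \<le> w" using T(2) c unfolding clique_le_def by blast
  moreover have "K \<inter> L = {}" using LK adj_irrefl by blast
  moreover have "finite K" "finite L" using finite_subset[OF _ T(1)] K(1) L(1) S(1) by blast+
  ultimately show "card L \<le> w - card K" by (simp add: card_Un_disjoint)
qed

lemma clique_le_nbhd:
  assumes "finite T" "clique_le T w" "x \<in> T" "S \<subseteq> T" "\<And>s. s \<in> S \<Longrightarrow> E x s"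
  shows "clique_le S (w - 1)"
proof -
  have "E s k" if "s \<in> S" "k \<in> {x}" for s k using that assms(5)[of s] adj_sym[of x s] by blast
  then have "clique_le S (w - card {x})"
    using clique_le_join[OF assms(1,2) _ _ assms(4), of "{x}"] assms(3) by (simp add: is_clique_def)
  then show ?thesis by simp
qed

lemma not_clique_le:
  assumes "\<not> clique_le S m" obtains K where "K \<subseteq> S" "is_clique K" "card K = Suc m"
proof -
  obtain L where L: "L \<subseteq> S" "is_clique L" "Suc m \<le> card L" using assms unfolding clique_le_def not_le
    by (auto simp: Suc_le_eq not_le)
  obtain K where K: "K \<subseteq> L" "card K = Suc m" using obtain_subset_with_card_n[OF L(3)] by blast
  have "K \<subseteq> S" "is_clique K" using K(1) L(1,2) unfolding is_clique_def by auto
  then show thesis using that K(2) by simp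
qed

lemma clique_in_component: "is_clique K \<Longrightarrow> K \<subseteq> S \<Longrightarrow> v \<in> K \<Longrightarrow> K \<subseteq> component S v"
  by (rule component_max[OF conn_clique, of K S v v]) (use component_refl[of v S] in auto)

lemma clique_le_small_components: "clique_le {v\<in>S. clique_le (component S v) m} m"
  unfolding clique_le_def[of "{v\<in>S. clique_le (component S v) m}"]
proof (intro allI impI)
  fix K assume K: "K \<subseteq> {v\<in>S. clique_le (component S v) m}" "is_clique K"
  show "card K \<le> m"
  proof (cases "K = {}")
    case False
    then obtain v where v: "v \<in> K" by blast
    then have "K \<subseteq> component S v" "clique_le (component S v) m" using clique_in_component[OF K(2) _ v, of S] K(1) by auto
    then show ?thesis using K(2) unfolding clique_le_def by blast
  qed simp
qed

lemma colourable_UN: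
  assumes "finite J" "\<And>j. j \<in> J \<Longrightarrow> colourable (A j) k" shows "colourable (\<Union>j\<in>J. A j) (card J * k)"
  using assms
proof (induction J)
  case empty
  then show ?case by (simp add: colourable_empty)
next
  case (insert j J)
  have "colourable (A j \<union> (\<Union>j\<in>J. A j)) (k + card J * k)" by (rule colourable_Un) (use insert in auto)
  then show ?case using insert by simp
qed

text \<open>Take a subfamily of least size with the same union: a member without a private element could be dropped.\<close>

lemma minimal_subcover:
  assumes "finite I"
  obtains J where "J \<subseteq> I" "(\<Union>j\<in>J. A j) = (\<Union>i\<in>I. A i)" "\<And>j. j \<in> J \<Longrightarrow> \<exists>y\<in>A j. \<forall>i\<in>J. i \<noteq> j \<longrightarrow> y \<notin> A i"
proof -
  obtain J where J: "J \<subseteq> I \<and> (\<Union>j\<in>J. A j) = (\<Union>i\<in>I. A i)"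
    and m: "\<And>J'. J' \<subseteq> I \<and> (\<Union>j\<in>J'. A j) = (\<Union>i\<in>I. A i) \<Longrightarrow> card J \<le> card J'"
    using ex_has_least_nat[of "\<lambda>J. J \<subseteq> I \<and> (\<Union>j\<in>J. A j) = (\<Union>i\<in>I. A i)" I card] by blast
  have "\<exists>y\<in>A j. \<forall>i\<in>J. i \<noteq> j \<longrightarrow> y \<notin> A i" if j: "j \<in> J" for j
  proof (rule ccontr)
    assume n: "\<not> ?thesis"
    have "(\<Union>i\<in>J - {j}. A i) = (\<Union>i\<in>J. A i)" using n by blast
    then have "card J \<le> card (J - {j})" using J by (intro m) auto
    moreover have "finite J" using J assms finite_subset by blast
    ultimately show False using j by (metis card_Diff1_less not_le)
  qed
  then show thesis using that J by blast
qed

end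

context p5_free
begin

definition chi_bound :: "nat \<Rightarrow> nat \<Rightarrow> bool" where
  "chi_bound w k \<longleftrightarrow> (\<forall>S. finite S \<longrightarrow> clique_le S w \<longrightarrow> colourable S k)"

lemma chi_boundD: "chi_bound w k \<Longrightarrow> finite S \<Longrightarrow> clique_le S w \<Longrightarrow> colourable S k"
  unfolding chi_bound_def by blast

lemma chi_bound_mono: "chi_bound w k \<Longrightarrow> v \<le> w \<Longrightarrow> k \<le> l \<Longrightarrow> chi_bound v l"
  unfolding chi_bound_def using clique_le_mono[OF _ order.refl] colourable_mono[OF _ order.refl] by blast

lemma private_adjacent:
  assumes y: "y \<in> N" "E x y" "t \<in> component W r" "E y t" "\<And>s. s \<in> component W r' \<Longrightarrow> \<not> E y s"
    and y': "y' \<in> N" "E x y'" "t' \<in> component W r'" "E y' t'" "\<And>s. s \<in> component W r \<Longrightarrow> \<not> E y' s"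
    and W: "\<And>s. s \<in> W \<Longrightarrow> \<not> E x s" and ne: "component W r \<noteq> component W r'"
  shows "E y y'"
proof (rule ccontr)
  assume n: "\<not> E y y'"
  have t: "t \<in> W" "t' \<in> W" using y(3) y'(3) component_sub by auto
  have "\<not> E t t'"
  proof
    assume "E t t'"
    then have "t' \<in> component W r" using component_step[OF y(3)] t by blast
    then show False using component_eq y'(3) ne by metis
  qed
  then show False
    using no_P5[of t y x y' t'] y y' n W[OF t(1)] W[OF t(2)] adj_sym by metis
qed

text \<open>Divide \<open>B\<close> into the neighbours \<open>N\<close> of \<open>x\<close> and the components of the other vertices. Components
without a clique of size \<open>m + 1\<close> take \<open>k2\<close> colours together. For a large component, its neighbours in
\<open>N\<close> are complete to it and take \<open>k3\<close> colours. A minimal choice of large components whose neighbours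
cover those of all of them has pairwise adjacent private neighbours (\<open>private_adjacent\<close>), which form a clique with \<open>x\<close>;
so there are at most \<open>w - 1\<close> of them. The remaining vertices of \<open>N\<close> and the large components are
anticomplete and each take \<open>k1\<close> colours.\<close>

lemma component_bound:
  assumes T: "finite T" "clique_le T w" and B: "B \<subseteq> T" "conn_set B" and x: "x \<in> T" "E u x" "\<And>b. b \<in> B \<Longrightarrow> \<not> E u b"
    and b0: "b0 \<in> B" "E x b0"
    and k: "chi_bound (w - 1) k1" "chi_bound m k2" "chi_bound (w - Suc m) k3"
  shows "colourable B (k1 + (w - 1) * k3 + k2)"
proof -
  have fin: "finite B" using T(1) B(1) finite_subset by blast
  define N where "N = {v\<in>B. E x v}"
  define W where "W = {v\<in>B. \<not> E x v}"
  have NW: "N \<subseteq> B" "W \<subseteq> B" "B \<subseteq> N \<union> W" unfolding N_def W_def by auto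
  define I where "I = {r\<in>W. \<not> clique_le (component W r) m}"
  define A where "A K = {y\<in>N. \<exists>t\<in>K. E y t}" for K
  have full: "E y s" if ys: "y \<in> A (component W r)" "s \<in> component W r" for y r s
  proof -
    obtain t where t: "y \<in> B" "E x y" "t \<in> component W r" "E y t" using ys(1) unfolding A_def N_def by blast
    show ?thesis using not_mixed[OF x(2), of B y t r s] x(3) t ys(2) unfolding W_def by blast
  qed
  have att: "A (component W r) \<noteq> {}" if rW: "r \<in> W" for r
  proof -
    obtain y t where "y \<in> B" "E x y" "t \<in> component W r" "E y t"
      using attached[OF B(2) b0, of r] rW unfolding W_def by blast
    then show ?thesis unfolding A_def N_def by blast
  qed
  have AT: "A K \<subseteq> T" for K using NW B(1) unfolding A_def by blast
  have cT: "component W r \<subseteq> T" for r using component_sub NW B(1) by blast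
  have cA: "colourable (A K) k3" if K: "K \<in> component W ` I" for K
  proof -
    obtain r where r: "K = component W r" "\<not> clique_le (component W r) m" using K unfolding I_def by blast
    obtain Q where Q: "Q \<subseteq> K" "is_clique Q" "card Q = Suc m" using not_clique_le[OF r(2)] r(1) by blast
    have "clique_le (A K) (w - card Q)"
      by (rule clique_le_join[OF T _ Q(2) AT]) (use Q(1) r(1) cT full in blast)+
    then show ?thesis using chi_boundD[OF k(3)] T(1) AT finite_subset Q(3) by metis
  qed
  have finI: "finite (component W ` I)" using fin NW(2) finite_subset unfolding I_def by (metis (no_types, lifting) finite_imageI mem_Collect_eq subsetI)
  obtain J where J: "J \<subseteq> component W ` I" "(\<Union>K\<in>J. A K) = (\<Union>K\<in>component W ` I. A K)"
    and Jp: "\<And>K. K \<in> J \<Longrightarrow> \<exists>y\<in>A K. \<forall>K'\<in>J. K' \<noteq> K \<longrightarrow> y \<notin> A K'"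
    using minimal_subcover[OF finI] by blast
  have finJ: "finite J" using J(1) finI finite_subset by blast
  obtain g where g: "\<And>K. K \<in> J \<Longrightarrow> g K \<in> A K \<and> (\<forall>K'\<in>J. K' \<noteq> K \<longrightarrow> g K \<notin> A K')"
    using Jp by metis
  have adj: "E (g K) (g K')" if K: "K \<in> J" "K' \<in> J" "K \<noteq> K'" for K K'
  proof -
    obtain r r' where r: "K = component W r" "K' = component W r'" using K J(1) by blast
    have G: "g K \<in> A K" "g K' \<in> A K'" "g K \<notin> A K'" "g K' \<notin> A K" using g K by auto
    obtain t where t: "t \<in> K" "E (g K) t" using G(1) unfolding A_def by blast
    obtain t' where t': "t' \<in> K'" "E (g K') t'" using G(2) unfolding A_def by blast
    have GN: "g K \<in> N" "g K' \<in> N" using G unfolding A_def by auto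
    have no: "\<And>s. s \<in> K' \<Longrightarrow> \<not> E (g K) s" "\<And>s. s \<in> K \<Longrightarrow> \<not> E (g K') s" using G GN unfolding A_def by auto
    show ?thesis
      by (rule private_adjacent[of "g K" N x t W r r' "g K'" t'])
        (use GN t t' no r K(3) in \<open>auto simp: N_def W_def\<close>)
  qed
  have inj: "inj_on g J" using adj adj_irrefl unfolding inj_on_def by metis
  have gN: "g ` J \<subseteq> N" using g unfolding A_def by blast
  have "is_clique (insert x (g ` J))"
    unfolding is_clique_def using adj gN adj_sym unfolding N_def by fastforce
  moreover have "insert x (g ` J) \<subseteq> T" using x(1) gN NW(1) B(1) by blast
  moreover have "x \<notin> g ` J" using gN adj_irrefl unfolding N_def by blast
  ultimately have "Suc (card (g ` J)) \<le> w" using T(2) finJ unfolding clique_le_def by (metis card_insert_disjoint finite_imageI)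
  then have cJ: "card J \<le> w - 1" using card_image[OF inj] by simp
  define Y where "Y = (\<Union>K\<in>J. A K)"
  have "colourable Y (card J * k3)" unfolding Y_def by (rule colourable_UN[OF finJ]) (use cA J(1) in blast)
  then have cY: "colourable Y ((w - 1) * k3)" using colourable_mono[OF _ order.refl] cJ mult_le_mono1 by blast
  have cS: "colourable {v\<in>W. clique_le (component W v) m} k2"
    by (rule chi_boundD[OF k(2) _ clique_le_small_components]) (use fin NW(2) finite_subset in fastforce)
  have "colourable (W \<inter> I) k1"
  proof (rule colourable_comps)
    fix r assume r: "r \<in> W"
    obtain y where y: "y \<in> A (component W r)" using att[OF r] by blast
    have "clique_le (component W r) (w - 1)"
      by (rule clique_le_nbhd[OF T _ cT]) (use y AT full in blast)+
    then have "colourable (component W r) k1" using chi_boundD[OF k(1)] T(1) cT finite_subset by metis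
    then show "colourable (component W r \<inter> I) k1" using colourable_mono by blast
  qed
  then have cI: "colourable I k1" by (simp add: I_def Int_def)
  have "clique_le (N - Y) (w - 1)"
    by (rule clique_le_nbhd[OF T x(1)]) (use NW B(1) in \<open>auto simp: N_def\<close>)
  then have cN: "colourable (N - Y) k1" using chi_boundD[OF k(1)] fin NW(1) by (meson finite_Diff finite_subset)
  have "anticomplete (N - Y) I" unfolding anticomplete_def
  proof (intro ballI notI)
    fix a r assume a: "a \<in> N - Y" "r \<in> I" "E a r"
    have "r \<in> component W r" using a(2) component_refl unfolding I_def by blast
    then have "a \<in> A (component W r)" using a unfolding A_def by blast
    then show False using a(1,2) J(2) unfolding Y_def by blast
  qed
  then have "colourable ((N - Y) \<union> I) k1" by (rule colourable_anti[OF cN cI])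
  then have "colourable ((((N - Y) \<union> I) \<union> Y) \<union> {v\<in>W. clique_le (component W v) m}) (k1 + (w - 1) * k3 + k2)"
    by (intro colourable_Un cY cS)
  then show ?thesis by (rule colourable_mono) (use NW(3) in \<open>auto simp: I_def\<close>)
qed

lemma cutset_bound:
  assumes V: "conn_set V" "finite V" "clique_le V w" and s: "separates V X C D"
    and k: "chi_bound (w - 1) k1" "chi_bound m k2" "chi_bound (w - Suc m) k3"
  shows "colourable (V - X) (k1 + (w - 1) * k3 + k2)"
proof (rule colourable_comps')
  fix u assume u: "u \<in> V - X"
  obtain b x where bx: "b \<in> component (V - X) u" "x \<in> X" "E x b" using separates_attached[OF s V(1) u] by blast
  obtain D' where D': "conn_set D'" "D' \<subseteq> V - X" "anticomplete (component (V - X) u) D'" "\<forall>x\<in>X. \<exists>d\<in>D'. E x d"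
    using separates_other[OF s u] by blast
  obtain d where d: "d \<in> D'" "E x d" using D'(4) bx(2) by blast
  show "colourable (component (V - X) u) (k1 + (w - 1) * k3 + k2)"
  proof (rule component_bound[OF V(2,3) _ component_conn[OF u] _ _ _ bx(1,3) k])
    show "component (V - X) u \<subseteq> V" using component_sub by blast
    show "x \<in> V" using bx(2) separatesD(1)[OF s] by blast
    show "E d x" by (rule adj_sym[OF d(2)])
    show "\<not> E d b" if "b \<in> component (V - X) u" for b using D'(3) d(1) that adj_sym[of d b] unfolding anticomplete_def by blast
  qed
qed

text \<open>Each vertex of a minimal cutset between the two cliques is complete to one of them, so the cutset takes
twice \<open>k3\<close> colours.\<close>

lemma bound_if_anti_cliques:
  assumes V: "conn_set V" "finite V" "clique_le V w"
    and P: "P \<subseteq> V" "is_clique P" "card P = Suc m" and Q: "Q \<subseteq> V" "is_clique Q" "card Q = Suc m"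
    and PQ: "anticomplete P Q" "P \<inter> Q = {}"
    and k: "chi_bound (w - 1) k1" "chi_bound m k2" "chi_bound (w - Suc m) k3"
  shows "colourable V (k1 + (w + 1) * k3 + k2)"
proof -
  have ne: "P \<noteq> {}" "Q \<noteq> {}" using P(3) Q(3) by auto
  obtain X C D where s: "separates V X C D" and sub: "Q \<subseteq> C" "P \<subseteq> D"
    and "\<forall>x\<in>X. \<exists>p\<in>P. E x p"
    by (rule separates_exists[OF conn_clique[OF P(2) ne(1)] conn_clique[OF Q(2) ne(2)] P(1) Q(1) PQ])
  note sD = separatesD[OF s]
  have one: "colourable X' k3" if "X' \<subseteq> X" and K: "K \<subseteq> V" "is_clique K" "card K = Suc m" "\<And>x k. x \<in> X' \<Longrightarrow> k \<in> K \<Longrightarrow> E x k" for X' K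
  proof -
    have X': "X' \<subseteq> V" using that(1) sD(1) by blast
    have "clique_le X' (w - card K)" by (rule clique_le_join[OF V(2,3) K(1,2) X' K(4)])
    then show ?thesis using chi_boundD[OF k(3) finite_subset[OF X' V(2)]] K(3) by simp
  qed
  define X1 where "X1 = {x\<in>X. \<forall>c\<in>C. E x c}"
  have "colourable X1 k3" by (rule one[OF _ Q]) (use sub in \<open>auto simp: X1_def\<close>)
  moreover have "colourable (X - X1) k3"
  proof (rule one[OF _ P])
    fix x p assume x: "x \<in> X - X1" and p: "p \<in> P"
    then obtain c where c: "c \<in> C" "\<not> E x c" unfolding X1_def by blast
    obtain c' d where "c' \<in> C" "E x c'" "d \<in> D" "E x d" using sD(8,9)[of x] x by blast
    then show "E x p" using separates_complete[OF sD(4,5,7)] c p sub by blast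
  qed blast
  ultimately have "colourable (X1 \<union> (X - X1) \<union> (V - X)) (k3 + k3 + (k1 + (w - 1) * k3 + k2))"
    by (intro colourable_Un cutset_bound[OF V s k])
  moreover have "Suc m \<le> w" using V(3) P unfolding clique_le_def by metis
  then have "k3 + k3 + (k1 + (w - 1) * k3 + k2) = k1 + (w + 1) * k3 + k2" by (cases w) (auto simp: algebra_simps)
  moreover have "V \<subseteq> X1 \<union> (X - X1) \<union> (V - X)" by blast
  ultimately show ?thesis using colourable_mono[of "X1 \<union> (X - X1) \<union> (V - X)" _ V] by simp
qed

text \<open>If some vertex has only small cliques among its non-neighbours, \<open>k1 + k2\<close> colours are enough. Otherwise
there are cutsets with a component \<open>C\<close> containing a large clique, and one is chosen whose second component \<open>D\<close> is largest.
For \<open>x\<close> in the cutset and complete to \<open>D\<close>, a large clique among the non-neighbours of \<open>x\<close> in \<open>C\<close>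
could be separated from \<open>D\<close> enlarged by \<open>x\<close>, against the choice of \<open>D\<close>. All components other than
\<open>C\<close> have small cliques only and reuse the colours of \<open>C\<close>.\<close>

lemma bound_if_no_anti_cliques:
  assumes V: "conn_set V" "finite V" "clique_le V w" and m: "m \<ge> 1"
    and no: "\<And>P Q. \<lbrakk>P \<subseteq> V; is_clique P; card P = Suc m; Q \<subseteq> V; is_clique Q; card Q = Suc m; anticomplete P Q; P \<inter> Q = {}\<rbrakk> \<Longrightarrow> False"
    and k: "chi_bound (w - 1) k1" "chi_bound m k2" "chi_bound (w - Suc m) k3"
    and l: "k1 + k2 \<le> l" "k1 + (w - 1) * k3 + k2 + (k3 + k2) \<le> l" "k1 + 2 * k3 + Suc m * k2 \<le> l"
  shows "colourable V l"
proof -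
  define far where "far v = {t\<in>V. t \<noteq> v \<and> \<not> E v t}" for v
  obtain v where v: "v \<in> V" using V(1) unfolding conn_set_def by blast
  show ?thesis
  proof (cases "clique_le (far v) m")
    case True
    have N: "clique_le {t\<in>V. E v t} (w - 1)" by (rule clique_le_nbhd[OF V(2,3) v]) auto
    have M: "clique_le {t\<in>V. \<not> E v t} m" unfolding clique_le_def
    proof (intro allI impI)
      fix K assume K: "K \<subseteq> {t\<in>V. \<not> E v t}" "is_clique K"
      show "card K \<le> m"
      proof (cases "v \<in> K")
        case True
        have "t = v" if t: "t \<in> K" for t
        proof (rule ccontr)
          assume "t \<noteq> v"
          then have "E v t" using K(2) True t unfolding is_clique_def by simp
          then show False using K(1) t by blast
        qed
        then have "K = {v}" using True by blast
        then show ?thesis using m by simp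
      next
        case False
        then have "K \<subseteq> far v" using K(1) unfolding far_def by blast
        then show ?thesis using \<open>clique_le (far v) m\<close> K(2) unfolding clique_le_def by blast
      qed
    qed
    have "colourable {t\<in>V. E v t} k1" "colourable {t\<in>V. \<not> E v t} k2"
      using chi_boundD[OF k(1) _ N] chi_boundD[OF k(2) _ M] V(2) by auto
    then show ?thesis by (rule colourable_cover) (use l(1) in auto)
  next
    case False
    then obtain Q where Q: "Q \<subseteq> far v" "is_clique Q" "card Q = Suc m" by (rule not_clique_le)
    \<comment> \<open>The second components of cutsets whose first component contains a large clique.\<close>
    define good where "good t \<longleftrightarrow> (\<exists>X C. separates V X C t \<and> \<not> clique_le C m)" for t
    have big: "\<not> clique_le C m" if "Q' \<subseteq> C" "is_clique Q'" "card Q' = Suc m" for Q' C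
      using that unfolding clique_le_def by (metis not_less_eq_eq order.refl)
    have Qne: "Q \<noteq> {}" using Q(3) by auto
    have vQ: "{v} \<subseteq> V" "Q \<subseteq> V" "anticomplete {v} Q" "{v} \<inter> Q = {}" using Q(1) v unfolding anticomplete_def far_def by auto
    obtain X0 C0 D0 where "separates V X0 C0 D0" "Q \<subseteq> C0" "{v} \<subseteq> D0" "\<forall>x\<in>X0. \<exists>p\<in>{v}. E x p"
      by (rule separates_exists[OF conn_single[of v] conn_clique[OF Q(2) Qne] vQ])
    then have g0: "good D0" using big[OF _ Q(2,3)] unfolding good_def by blast
    have "card D < Suc (card V)" if "good D" for D
    proof -
      have "D \<subseteq> V" using that separatesD(3) unfolding good_def by blast
      then show ?thesis using card_mono[OF V(2)] by (simp add: le_imp_less_Suc)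
    qed
    then obtain D where D: "good D" and Dmax: "\<And>D'. good D' \<Longrightarrow> card D' \<le> card D"
      using ex_has_greatest_nat[of good D0 card "Suc (card V)"] g0 by (metis less_imp_le)
    obtain X C where s: "separates V X C D" and C: "\<not> clique_le C m" using D unfolding good_def by blast
    note sD = separatesD[OF s]
    obtain R where R: "R \<subseteq> C" "is_clique R" "card R = Suc m" by (rule not_clique_le[OF C])
    have finV: "finite A" if "A \<subseteq> V" for A using that V(2) finite_subset by blast
    define X1 where "X1 = {x\<in>X. \<forall>c\<in>C. E x c}"
    define X2 where "X2 = X - X1"
    have "clique_le X1 (w - card R)"
      by (rule clique_le_join[OF V(2,3) _ R(2)]) (use R(1) sD(1,2) in \<open>auto simp: X1_def\<close>)
    then have cX1: "colourable X1 k3" using chi_boundD[OF k(3) finV] R(3) sD(1) by (metis (no_types, lifting) X1_def mem_Collect_eq subset_iff)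
    have X2D: "E x d" if x: "x \<in> X2" "d \<in> D" for x d
    proof -
      obtain c where c: "c \<in> C" "\<not> E x c" using x unfolding X1_def X2_def by blast
      obtain c' d' where "c' \<in> C" "E x c'" "d' \<in> D" "E x d'" using sD(8,9)[of x] x unfolding X2_def by blast
      then show ?thesis using separates_complete[OF sD(4,5,7)] c x by blast
    qed
    obtain d0 where d0: "d0 \<in> D" using sD(5) unfolding conn_set_def by blast
    show ?thesis
    proof (cases "clique_le X2 m")
      case True
      then have "colourable X2 k2" by (intro chi_boundD[OF k(2)] finV) (use sD(1) in \<open>auto simp: X2_def\<close>)
      then have "colourable (V - X \<union> (X1 \<union> X2)) (k1 + (w - 1) * k3 + k2 + (k3 + k2))"
        by (intro colourable_Un cX1 cutset_bound[OF V s k])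
      then show ?thesis by (rule colourable_mono) (use l(2) in \<open>auto simp: X2_def\<close>)
    next
      case False
      then obtain P where P: "P \<subseteq> X2" "is_clique P" "card P = Suc m" by (rule not_clique_le)
      have PV: "P \<subseteq> V" using P(1) sD(1) unfolding X2_def by blast
      have small: "clique_le {c\<in>C. \<not> E x c} m" if x: "x \<in> X2" for x
      proof (rule ccontr)
        assume "\<not> clique_le {c\<in>C. \<not> E x c} m"
        then obtain Q' where Q': "Q' \<subseteq> {c\<in>C. \<not> E x c}" "is_clique Q'" "card Q' = Suc m" by (rule not_clique_le)
        have Q'ne: "Q' \<noteq> {}" using Q'(3) by auto
        have xX: "x \<in> X" "x \<notin> D" using x sD(3) unfolding X2_def by auto
        have c1: "conn_set (insert x D)" using conn_insert[OF sD(5) d0 X2D[OF x d0]] .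
        have c2: "anticomplete (insert x D) Q'" unfolding anticomplete_def
        proof (intro ballI)
          fix a b assume "a \<in> insert x D" "b \<in> Q'"
          then show "\<not> E a b" using Q'(1) sD(7) adj_sym[of a b] unfolding anticomplete_def by blast
        qed
        have c3: "insert x D \<inter> Q' = {}" using Q'(1) sD(2,6) xX(1) by blast
        have c4: "insert x D \<subseteq> V" "Q' \<subseteq> V" using sD(1,2,3) xX(1) Q'(1) by auto
        obtain X' C' D' where s': "separates V X' C' D'" and sub: "Q' \<subseteq> C'" "insert x D \<subseteq> D'"
          and "\<forall>y\<in>X'. \<exists>p\<in>insert x D. E y p"
          by (rule separates_exists[OF c1 conn_clique[OF Q'(2) Q'ne] c4 c2 c3])
        have "good D'" using s' big[OF sub(1) Q'(2,3)] unfolding good_def by blast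
        moreover have "card D < card D'"
          by (rule psubset_card_mono) (use finV separatesD(3)[OF s'] sub(2) xX(2) in blast)+
        ultimately show False using Dmax by force
      qed
      have "clique_le {c\<in>C. \<forall>p\<in>P. E p c} (w - card P)"
        by (rule clique_le_join[OF V(2,3) PV P(2)]) (use sD(2) adj_sym in auto)
      then have c1: "colourable {c\<in>C. \<forall>p\<in>P. E p c} k3" using chi_boundD[OF k(3) finV] P(3) sD(2) by (metis (no_types, lifting) Diff_iff mem_Collect_eq subset_iff)
      have u: "colourable (\<Union>p\<in>P. {c\<in>C. \<not> E p c}) (card P * k2)"
        by (rule colourable_UN[OF finV[OF PV]], rule chi_boundD[OF k(2) finV small]) (use sD(2) P(1) in auto)
      have "colourable ({c\<in>C. \<forall>p\<in>P. E p c} \<union> (\<Union>p\<in>P. {c\<in>C. \<not> E p c})) (k3 + Suc m * k2)"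
        using colourable_Un[OF c1 u] unfolding P(3) .
      then have cC: "colourable C (k3 + Suc m * k2)" by (rule colourable_mono) auto
      have ZC: "anticomplete (V - X - C) C" unfolding anticomplete_def
      proof (intro ballI notI)
        fix a c assume ac: "a \<in> V - X - C" "c \<in> C" "E a c"
        obtain c0 where "C = component (V - X) c0" using s unfolding separates_def by blast
        then show False using component_step[of c "V - X" c0 a] ac adj_sym[OF ac(3)] by blast
      qed
      have "clique_le (V - X - C) m"
      proof (rule ccontr)
        assume "\<not> clique_le (V - X - C) m"
        then obtain Q' where Q': "Q' \<subseteq> V - X - C" "is_clique Q'" "card Q' = Suc m" by (rule not_clique_le)
        have "anticomplete Q' R" using ZC Q'(1) R(1) unfolding anticomplete_def by blast
        then show False using no[of Q' R] Q' R sD(2) by blast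
      qed
      then have "colourable (V - X - C) k2" by (intro chi_boundD[OF k(2)] finV) auto
      then have "colourable (V - X - C) (k3 + Suc m * k2)" by (rule colourable_mono) auto
      then have cc: "colourable ((V - X - C) \<union> C) (k3 + Suc m * k2)" by (rule colourable_anti[OF _ cC ZC])
      have d0V: "d0 \<in> V" using d0 sD(3) by blast
      have X2V: "X2 \<subseteq> V" using sD(1) unfolding X2_def by blast
      have "clique_le X2 (w - 1)" by (rule clique_le_nbhd[OF V(2,3) d0V X2V]) (use X2D d0 adj_sym in blast)
      then have "colourable X2 k1" by (intro chi_boundD[OF k(1)] finV X2V)
      then have "colourable (X2 \<union> (X1 \<union> ((V - X - C) \<union> C))) (k1 + (k3 + (k3 + Suc m * k2)))"
        by (intro colourable_Un cX1 cc)
      then show ?thesis by (rule colourable_mono) (use l(3) in \<open>auto simp: X2_def\<close>)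
    qed
  qed
qed

theorem chi_bound_rec:
  assumes k: "chi_bound (w - 1) k1" "chi_bound m k2" "chi_bound (w - Suc m) k3" and m: "m \<ge> 1"
    and l: "k1 + (w + 1) * k3 + k2 \<le> l" "k1 + (w - 1) * k3 + k2 + (k3 + k2) \<le> l" "k1 + 2 * k3 + Suc m * k2 \<le> l"
  shows "chi_bound w l"
  unfolding chi_bound_def
proof (intro allI impI, rule colourable_comps')
  fix S u assume S: "finite S" "clique_le S w" and u: "u \<in> S"
  define V where "V = component S u"
  have V: "conn_set V" "finite V" "clique_le V w"
    using component_conn[OF u] finite_subset[OF component_sub S(1)] clique_le_mono[OF S(2) component_sub order.refl]
    unfolding V_def .
  show "colourable (component S u) l"
  proof (cases "\<exists>P Q. P \<subseteq> V \<and> is_clique P \<and> card P = Suc m \<and> Q \<subseteq> V \<and> is_clique Q \<and> card Q = Suc m \<and> anticomplete P Q \<and> P \<inter> Q = {}")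
    case True
    then obtain P Q where PQ: "P \<subseteq> V" "is_clique P" "card P = Suc m" "Q \<subseteq> V" "is_clique Q" "card Q = Suc m" "anticomplete P Q" "P \<inter> Q = {}" by blast
    have "colourable V (k1 + (w + 1) * k3 + k2)" by (rule bound_if_anti_cliques[OF V PQ k])
    then have "colourable V l" by (rule colourable_mono[OF _ order.refl l(1)])
    then show ?thesis by (simp add: V_def)
  next
    case False
    have no: False if "P \<subseteq> V" "is_clique P" "card P = Suc m" "Q \<subseteq> V" "is_clique Q" "card Q = Suc m" "anticomplete P Q" "P \<inter> Q = {}" for P Q
      using False that by blast
    have kl: "k1 + k2 \<le> l" using l(2) by linarith
    have "colourable V l" by (rule bound_if_no_anti_cliques[OF V m _ k kl l(2,3)]) (rule no)
    then show ?thesis by (simp add: V_def)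
  qed
qed

end

section \<open>The function x powr log 2 x\<close>

definition pow_log :: "real \<Rightarrow> real" where "pow_log x = x powr log 2 x"

lemma pow_log_exp: "x > 0 \<Longrightarrow> pow_log x = exp ((ln x)\<^sup>2 / ln 2)"
  by (simp add: pow_log_def powr_def log_def power2_eq_square mult.commute)

lemma pow_log_mono: "1 \<le> x \<Longrightarrow> x \<le> y \<Longrightarrow> pow_log x \<le> pow_log y"
  unfolding pow_log_exp[of x] by (simp add: pow_log_exp divide_right_mono power_mono)

text \<open>Halving divides the function by \<open>x\<^sup>2 / 2\<close>, while the recursion has only about \<open>x\<close> summands of this
size.\<close>

lemma pow_log_half: assumes "x > 0" shows "pow_log (x / 2) = pow_log x * 2 / x\<^sup>2"
proof -
  have "(ln (x / 2))\<^sup>2 / ln 2 = (ln x)\<^sup>2 / ln 2 + ln 2 - 2 * ln x"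
    using assms by (simp add: ln_div power2_eq_square field_simps)
  then have "pow_log (x / 2) = exp ((ln x)\<^sup>2 / ln 2 + ln 2 - 2 * ln x)" using assms by (simp add: pow_log_exp)
  also have "\<dots> = pow_log x * 2 / exp (2 * ln x)" using assms by (simp add: pow_log_exp exp_add exp_diff)
  also have "exp (2 * ln x) = x\<^sup>2" using assms by (simp add: exp_double)
  finally show ?thesis .
qed

text \<open>With \<open>z = 4 / x\<close>, the quotient of consecutive values is at most \<open>exp (- z)\<close>, because \<open>ln x - ln (x - 1)\<close>
is at least \<open>1 / x\<close> and \<open>ln x + ln (x - 1)\<close> is at least \<open>ln 16\<close>. The quadratic Taylor bound for
\<open>exp z\<close> turns this into a rational inequality.\<close>

lemma pow_log_pred: assumes "x \<ge> 6" shows "pow_log (x - 1) * (x\<^sup>2 + 4 * x + 8) \<le> pow_log x * x\<^sup>2"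
proof -
  define z where "z = 4 / x"
  have "1 / x \<le> ln x - ln (x - 1)"
  proof -
    have "ln ((x - 1) / x) \<le> (x - 1) / x - 1" by (rule ln_le_minus_one) (use assms in auto)
    also have "\<dots> = - 1 / x" using assms by (simp add: field_simps)
    finally show ?thesis using assms by (simp add: ln_div)
  qed
  moreover have "4 * ln 2 \<le> ln x + ln (x - 1)"
  proof -
    have "ln (4::real) = 2 * ln 2" using ln_realpow[of 2 2] by simp
    moreover have "ln 4 \<le> ln x" "ln 4 \<le> ln (x - 1)" using assms by auto
    ultimately show ?thesis by linarith
  qed
  ultimately have "1 / x * (4 * ln 2) \<le> (ln x - ln (x - 1)) * (ln x + ln (x - 1))"
    using assms by (intro mult_mono) (auto simp: divide_nonneg_nonneg order_trans[of 0 "1/x"])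
  then have "z * ln 2 \<le> (ln x)\<^sup>2 - (ln (x - 1))\<^sup>2" by (simp add: z_def power2_eq_square algebra_simps)
  then have "z \<le> ((ln x)\<^sup>2 - (ln (x - 1))\<^sup>2) / ln 2" by (simp add: pos_le_divide_eq)
  then have le: "z + (ln (x - 1))\<^sup>2 / ln 2 \<le> (ln x)\<^sup>2 / ln 2" by (simp add: diff_divide_distrib)
  have "1 + z + z\<^sup>2 / 2 \<le> exp z" by (rule exp_lower_Taylor_quadratic) (use assms in \<open>simp add: z_def\<close>)
  then have "pow_log (x - 1) * (1 + z + z\<^sup>2 / 2) \<le> pow_log (x - 1) * exp z"
    using assms by (intro mult_left_mono) (auto simp: pow_log_def)
  also have "\<dots> = exp (z + (ln (x - 1))\<^sup>2 / ln 2)" using assms by (simp add: pow_log_exp exp_add)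
  also have "\<dots> \<le> pow_log x" using le assms by (simp add: pow_log_exp)
  finally have "pow_log (x - 1) * (1 + z + z\<^sup>2 / 2) * x\<^sup>2 \<le> pow_log x * x\<^sup>2" by (rule mult_right_mono) simp
  moreover have "(1 + z + z\<^sup>2 / 2) * x\<^sup>2 = x\<^sup>2 + 4 * x + 8"
    using assms by (simp add: z_def field_simps power2_eq_square)
  ultimately show ?thesis by (simp add: mult.assoc)
qed

lemma pow_log_rec: assumes "x \<ge> 6" shows "pow_log (x - 1) + (x + 2) * pow_log (x / 2) \<le> pow_log x"
proof -
  have gx: "pow_log x > 0" using assms by (simp add: pow_log_def)
  have q: "x\<^sup>2 + 4 * x + 8 > 0" using assms by (simp add: add_pos_nonneg)
  have "6 * x \<le> x * x" using assms by (intro mult_right_mono) auto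
  then have sq: "4 * x + 8 \<le> x\<^sup>2" using assms unfolding power2_eq_square by linarith
  have "pow_log (x - 1) \<le> pow_log x * (x\<^sup>2 / (x\<^sup>2 + 4 * x + 8))"
    using pow_log_pred[OF assms] q by (simp add: pos_le_divide_eq)
  moreover have "x\<^sup>2 / (x\<^sup>2 + 4 * x + 8) = 1 - (4 * x + 8) / (x\<^sup>2 + 4 * x + 8)"
    using q by (simp add: field_simps)
  moreover have "(4 * x + 8) / (2 * x\<^sup>2) \<le> (4 * x + 8) / (x\<^sup>2 + 4 * x + 8)"
    by (rule divide_left_mono) (use assms sq q in auto)
  moreover have "(4 * x + 8) / (2 * x\<^sup>2) = (x + 2) * (2 / x\<^sup>2)" using assms by (simp add: field_simps)
  ultimately have "pow_log (x - 1) \<le> pow_log x * (1 - (x + 2) * (2 / x\<^sup>2))"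
    using gx by (smt (verit) mult_left_mono)
  moreover have "(x + 2) * pow_log (x / 2) = pow_log x * ((x + 2) * (2 / x\<^sup>2))" using pow_log_half[of x] assms by simp
  ultimately show ?thesis by (simp add: algebra_simps)
qed

lemma pow_log_rec_floor:
  assumes w: "w \<ge> 6"
  shows "nat \<lfloor>pow_log (real (w - 1))\<rfloor> + (w + 2) * nat \<lfloor>pow_log (real (w div 2))\<rfloor> \<le> nat \<lfloor>pow_log (real w)\<rfloor>"
proof -
  have fl: "real (nat \<lfloor>pow_log y\<rfloor>) \<le> pow_log y" if "y \<ge> 1" for y
    using that by (simp add: pow_log_def)
  have 1: "real (nat \<lfloor>pow_log (real (w - 1))\<rfloor>) \<le> pow_log (real w - 1)" using fl[of "real (w - 1)"] w by (simp add: of_nat_diff)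
  have "real (nat \<lfloor>pow_log (real (w div 2))\<rfloor>) \<le> pow_log (real (w div 2))" using w by (intro fl) auto
  also have "\<dots> \<le> pow_log (real w / 2)"
    by (rule pow_log_mono) (use w real_of_nat_div[of 2 w] in auto)
  finally have 2: "real (nat \<lfloor>pow_log (real (w div 2))\<rfloor>) \<le> pow_log (real w / 2)" .
  have "real (nat \<lfloor>pow_log (real (w - 1))\<rfloor> + (w + 2) * nat \<lfloor>pow_log (real (w div 2))\<rfloor>)
     \<le> pow_log (real w - 1) + (real w + 2) * pow_log (real w / 2)"
    using add_mono[OF 1 mult_left_mono[OF 2, of "real w + 2"]] by (simp add: algebra_simps)
  also have "\<dots> \<le> pow_log (real w)" using w by (intro pow_log_rec) simp
  finally show ?thesis by (simp add: le_nat_floor)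
qed

lemma pow_log_values: "nat \<lfloor>pow_log 3\<rfloor> \<ge> 5" "nat \<lfloor>pow_log 4\<rfloor> \<ge> 16" "nat \<lfloor>pow_log 5\<rfloor> \<ge> 37"
proof -
  have "(3/2::real) \<le> log 2 3"
  proof -
    have "log 2 (2 powr (3/2)) \<le> log 2 (3::real)"
    proof (rule log_mono)
      have "(2 powr (3/2)) ^ 2 \<le> (3::real) ^ 2" by (simp add: powr_power)
      then show "2 powr (3/2) \<le> (3::real)" by (rule power2_le_imp_le) simp
    qed auto
    then show ?thesis by simp
  qed
  then have "3 powr (3/2) \<le> pow_log 3" unfolding pow_log_def by simp
  moreover have "(5::real) \<le> 3 powr (3/2)"
  proof (rule power2_le_imp_le)
    show "5\<^sup>2 \<le> ((3::real) powr (3/2))\<^sup>2" by (simp add: powr_power)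
  qed simp
  ultimately show "nat \<lfloor>pow_log 3\<rfloor> \<ge> 5" by (simp add: le_nat_floor)
  have "log 2 4 = (2::real)" by (simp add: log_def) (use ln_realpow[of 2 2] in simp)
  then have "pow_log 4 = 16" unfolding pow_log_def by simp
  then show "nat \<lfloor>pow_log 4\<rfloor> \<ge> 16" by simp
  have "(9/4::real) \<le> log 2 5"
  proof -
    have "log 2 (2 powr (9/4)) \<le> log 2 (5::real)"
    proof (rule log_mono)
      have "(2 powr (9/4)) ^ 4 \<le> (5::real) ^ 4" by (simp add: powr_power)
      then show "2 powr (9/4) \<le> (5::real)" by (rule power_le_imp_le_base[of _ 3, simplified]) simp_all
    qed auto
    then show ?thesis by simp
  qed
  then have "5 powr (9/4) \<le> pow_log 5" unfolding pow_log_def by simp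
  moreover have "(37::real) \<le> 5 powr (9/4)"
  proof -
    have "37 ^ 4 \<le> ((5::real) powr (9/4)) ^ 4" by (simp add: powr_power)
    then show ?thesis by (rule power_le_imp_le_base[of _ 3, simplified]) simp_all
  qed
  ultimately show "nat \<lfloor>pow_log 5\<rfloor> \<ge> 37" by (simp add: le_nat_floor)
qed

section \<open>The bound for every clique number\<close>

context p5_free
begin

lemma chi_bound_1: "chi_bound 1 1"
  unfolding chi_bound_def
proof (intro allI impI)
  fix S assume S: "clique_le S 1"
  have "stable S" unfolding stable_def
  proof (intro ballI notI)
    fix u v assume uv: "u \<in> S" "v \<in> S" "E u v"
    then have "u \<noteq> v" using adj_irrefl by auto
    then have "card {u, v} = 2" by simp
    moreover have "is_clique {u, v}" using uv(3) adj_sym unfolding is_clique_def by blast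
    moreover have "{u, v} \<subseteq> S" using uv by blast
    ultimately have "2 \<le> (1::nat)" using S unfolding clique_le_def by metis
    then show False by simp
  qed
  then show "colourable S 1" by (rule colourable_stable)
qed

lemma chi_bound_2: "chi_bound 2 3"
  unfolding chi_bound_def using triangle_free_colourable trifree_if_clique_le by blast

lemma chi_bound_3: "chi_bound 3 5"
  unfolding chi_bound_def
proof (intro allI impI, rule colourable_comps')
  fix S u assume S: "finite S" "clique_le S 3" "u \<in> S"
  show "colourable (component S u) 5"
    by (rule five_colourable_if_conn[OF component_conn[OF S(3)] finite_subset[OF component_sub S(1)] clique_le_mono[OF S(2) component_sub order.refl]])
qed

text \<open>The general form \<open>f (w - 1) + (w + 2) * f (w div 2)\<close> would give 23; the bound 16 needs that vertices complete to a
triangle are stable here, the third argument of the recursion.\<close>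

lemma chi_bound_4: "chi_bound 4 16"
  by (rule chi_bound_rec[of 4 5 2 3 1]) (use chi_bound_3 chi_bound_2 chi_bound_1 in simp_all)

lemma chi_bound_5: "chi_bound 5 37"
  by (rule chi_bound_rec[of 5 16 2 3 3]) (use chi_bound_4 chi_bound_2 in simp_all)

text \<open>Real values are rounded down, since numbers of colours are integers.\<close>

lemma chi_bound_pow_log: "w \<ge> 3 \<Longrightarrow> chi_bound w (nat \<lfloor>pow_log (real w)\<rfloor>)"
proof (induction w rule: less_induct)
  case (less w)
  consider "w = 3" | "w = 4" | "w = 5" | "w \<ge> 6" using less.prems by linarith
  then show ?case
  proof cases
    case 1 then show ?thesis using chi_bound_mono[OF chi_bound_3, of 3] pow_log_values by simp
  next
    case 2 then show ?thesis using chi_bound_mono[OF chi_bound_4, of 4] pow_log_values by simp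
  next
    case 3 then show ?thesis using chi_bound_mono[OF chi_bound_5, of 5] pow_log_values by simp
  next
    case 4
    define m k1 k2 l where "m = w div 2" and "k1 = nat \<lfloor>pow_log (real (w - 1))\<rfloor>"
      and "k2 = nat \<lfloor>pow_log (real (w div 2))\<rfloor>" and "l = nat \<lfloor>pow_log (real w)\<rfloor>"
    have m: "3 \<le> m" "m < w" "w - Suc m \<le> m" "m + 3 \<le> w + 2" using 4 unfolding m_def by auto
    have b1: "chi_bound (w - 1) k1" using less.IH[of "w - 1"] 4 unfolding k1_def by simp
    have b2: "chi_bound m k2" using less.IH[of m] m unfolding k2_def m_def by simp
    have b3: "chi_bound (w - Suc m) k2" by (rule chi_bound_mono[OF b2 m(3) order.refl])
    have rec: "k1 + (w + 2) * k2 \<le> l" using pow_log_rec_floor[OF 4] unfolding k1_def k2_def l_def .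
    obtain v where v: "w = Suc v" using 4 by (cases w) auto
    have "chi_bound w l"
    proof (rule chi_bound_rec[OF b1 b2 b3])
      show "k1 + (w + 1) * k2 + k2 \<le> l" "k1 + (w - 1) * k2 + k2 + (k2 + k2) \<le> l"
        using rec unfolding v by (auto simp: algebra_simps)
      have "(m + 3) * k2 \<le> (w + 2) * k2" using m(4) by (rule mult_le_mono1)
      then show "k1 + 2 * k2 + Suc m * k2 \<le> l" using rec by (simp add: algebra_simps)
    qed (use m in simp)
    then show ?thesis by (simp add: l_def)
  qed
qed

end

section \<open>From digraphs to adjacency relations\<close>

text \<open>An induced path of \<open>G\<close> is isomorphic to \<open>path_graph n\<close> by numbering its vertices and sending an arc to
the pair of numbers of its ends; this is injective on arcs because \<open>G\<close> has no parallel arcs.\<close>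

lemma induced_path_not_free:
  fixes G :: "('a, 'b) pre_digraph" and v :: "nat \<Rightarrow> 'a"
  assumes G: "graph G" and inj: "inj_on v {..<n}" and verts: "v ` {..<n} \<subseteq> verts G"
    and adj: "\<And>i j. \<lbrakk>i < n; j < n\<rbrakk> \<Longrightarrow> v i \<rightarrow>\<^bsub>G\<^esub> v j \<longleftrightarrow> j = Suc i \<or> i = Suc j"
  shows "\<not> H_free (with_proj (path_graph n)) G"
proof -
  interpret G: graph G by fact
  define S where "S = v ` {..<n}"
  define K where "K = G \<restriction> S"
  have K: "induced_subgraph K G" unfolding K_def using verts by (intro G.induced_induce) (simp add: S_def)
  define i where "i = the_inv_into {..<n} v"
  have i: "i (v k) = k" if "k < n" for k unfolding i_def by (rule the_inv_into_f_f[OF inj]) (use that in simp)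
  define f where "f = \<lparr> iso_verts = i, iso_arcs = (\<lambda>e. (i (tail G e), i (head G e))), iso_head = snd, iso_tail = fst \<rparr>"
  have vK: "verts K = S" and aK: "arcs K = {e \<in> arcs G. tail G e \<in> S \<and> head G e \<in> S}"
    and tK: "tail K = tail G" "head K = head G" unfolding K_def by (auto simp: induce_subgraph_def)
  have iS: "inj_on i S" unfolding S_def by (rule inj_onI) (use i in auto)
  have wf: "wf_digraph K" using K G.induced_subgraph_altdef unfolding induced_subgraph_def subgraph_def by blast
  have "inj_on (iso_arcs f) (arcs K)"
  proof (rule inj_onI)
    fix e e' assume e: "e \<in> arcs K" "e' \<in> arcs K" "iso_arcs f e = iso_arcs f e'"
    then have "tail G e = tail G e'" "head G e = head G e'"
      using inj_onD[OF iS] unfolding f_def aK by auto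
    then show "e = e'" using e G.no_multi_arcs[of e e'] unfolding aK by (simp add: arc_to_ends_def)
  qed
  then have iso: "pre_digraph.digraph_isomorphism K f"
    unfolding pre_digraph.digraph_isomorphism_def using wf iS vK tK by (simp add: f_def)
  have vi: "i ` S = {..<n}" using i unfolding S_def by force
  have "(\<lambda>e. (i (tail G e), i (head G e))) ` arcs K = parcs (path_graph n)"
  proof (intro set_eqI iffI)
    fix p assume "p \<in> (\<lambda>e. (i (tail G e), i (head G e))) ` arcs K"
    then obtain e where e: "e \<in> arcs G" "tail G e \<in> S" "head G e \<in> S" "p = (i (tail G e), i (head G e))"
      unfolding aK by blast
    then obtain k l where kl: "k < n" "l < n" "tail G e = v k" "head G e = v l" unfolding S_def by auto
    then have "v k \<rightarrow>\<^bsub>G\<^esub> v l" using G.in_arcs_imp_in_arcs_ends[OF e(1)] by simp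
    then show "p \<in> parcs (path_graph n)" using adj[OF kl(1,2)] kl e(4) i by (simp add: path_graph_def)
  next
    fix p assume "p \<in> parcs (path_graph n)"
    then obtain k l where kl: "p = (k, l)" "k < n" "l < n" "l = Suc k \<or> k = Suc l" by (auto simp: path_graph_def)
    then have "v k \<rightarrow>\<^bsub>G\<^esub> v l" using adj by blast
    then obtain e where "e \<in> arcs G" "tail G e = v k" "head G e = v l" by (auto simp: arcs_ends_def arc_to_ends_def)
    then have "e \<in> arcs K" "p = (i (tail G e), i (head G e))" using kl i unfolding aK S_def by auto
    then show "p \<in> (\<lambda>e. (i (tail G e), i (head G e))) ` arcs K" by blast
  qed
  then have "with_proj (path_graph n) = app_iso f K"
    using vi vK by (simp add: app_iso_def f_def with_proj_def path_graph_def)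
  then have "digraph_iso K (with_proj (path_graph n))" unfolding digraph_iso_def using iso by blast
  then show ?thesis unfolding H_free_def using K by blast
qed

lemma induced_P5:
  fixes G :: "('a, 'b) pre_digraph"
  assumes G: "graph G"
    and e: "a \<rightarrow>\<^bsub>G\<^esub> b" "b \<rightarrow>\<^bsub>G\<^esub> c" "c \<rightarrow>\<^bsub>G\<^esub> d" "d \<rightarrow>\<^bsub>G\<^esub> e"
    and n: "\<not> a \<rightarrow>\<^bsub>G\<^esub> c" "\<not> a \<rightarrow>\<^bsub>G\<^esub> d" "\<not> a \<rightarrow>\<^bsub>G\<^esub> e" "\<not> b \<rightarrow>\<^bsub>G\<^esub> d" "\<not> b \<rightarrow>\<^bsub>G\<^esub> e" "\<not> c \<rightarrow>\<^bsub>G\<^esub> e"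
  shows "\<not> H_free (with_proj (path_graph 5)) G"
proof -
  interpret G: graph G by fact
  define v where "v = nth [a, b, c, d, e]"
  have v: "v 0 = a" "v 1 = b" "v 2 = c" "v 3 = d" "v 4 = e" by (simp_all add: v_def)
  have s: "x \<rightarrow>\<^bsub>G\<^esub> y \<Longrightarrow> y \<rightarrow>\<^bsub>G\<^esub> x" for x y by (rule G.graph_symmetric)
  have ir: "\<not> x \<rightarrow>\<^bsub>G\<^esub> x" for x using G.adj_not_same by blast
  have n': "\<not> c \<rightarrow>\<^bsub>G\<^esub> a" "\<not> d \<rightarrow>\<^bsub>G\<^esub> a" "\<not> e \<rightarrow>\<^bsub>G\<^esub> a" "\<not> d \<rightarrow>\<^bsub>G\<^esub> b" "\<not> e \<rightarrow>\<^bsub>G\<^esub> b" "\<not> e \<rightarrow>\<^bsub>G\<^esub> c"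
    using n s by blast+
  have five: "{..<5} = {0, 1, 2, 3, 4::nat}" by auto
  have adj: "v i \<rightarrow>\<^bsub>G\<^esub> v j \<longleftrightarrow> j = Suc i \<or> i = Suc j" if "i < 5" "j < 5" for i j
  proof -
    have "\<forall>i\<in>{0, 1, 2, 3, 4}. \<forall>j\<in>{0, 1, 2, 3, 4}. v i \<rightarrow>\<^bsub>G\<^esub> v j \<longleftrightarrow> j = Suc i \<or> i = Suc j"
      by (simp only: ball_simps v) (simp add: e e[THEN s] n n' ir)
    then show ?thesis using that five by blast
  qed
  have "distinct [a, b, c, d, e]" using e e[THEN s] n n' ir by auto
  then have "inj_on v {..<5}" unfolding v_def by (rule inj_on_nth) simp
  moreover have "v ` {..<5} \<subseteq> verts G" unfolding five using e G.adj_in_verts v by auto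
  ultimately show ?thesis using induced_path_not_free[OF G _ _ adj] by blast
qed

theorem mainTheorem1:
  fixes G :: "('a, 'b) pre_digraph"
  assumes "graph G"
    and "H_free (with_proj (path_graph 5)) G"
    and "clique_number G \<ge> 3"
  shows "real (chromatic_number G)
           \<le> real (clique_number G) powr log 2 (real (clique_number G))"
proof -
  interpret G: graph G by fact
  define E where "E u v \<longleftrightarrow> u \<rightarrow>\<^bsub>G\<^esub> v" for u v
  interpret P: p5_free E
  proof
    show "E y x" if "E x y" for x y
      using that unfolding E_def by (rule G.graph_symmetric)
    show "\<not> E x x" for x using G.adj_not_same unfolding E_def by blast
    show False if "E a b" "E b c" "E c d" "E d e" "\<not> E a c" "\<not> E a d" "\<not> E a e" "\<not> E b d" "\<not> E b e" "\<not> E c e" for a b c d e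
      using induced_P5[OF assms(1)] that assms(2) unfolding E_def by blast
  qed
  define w where "w = clique_number G"
  have cl: "P.clique_le (verts G) w" unfolding P.clique_le_def
  proof (intro allI impI)
    fix K assume K: "K \<subseteq> verts G" "P.is_clique K"
    then have "clique G K" unfolding clique_def P.is_clique_def E_def by blast
    then show "card K \<le> w"
      unfolding w_def clique_number_def using cliques_finite_nonempty[OF assms(1)] by (intro Max_ge) auto
  qed
  have "P.colourable (verts G) (nat \<lfloor>pow_log (real w)\<rfloor>)"
    by (rule P.chi_boundD[OF P.chi_bound_pow_log _ cl]) (use assms(3) w_def in auto)
  then obtain c where c: "\<forall>v\<in>verts G. c v < nat \<lfloor>pow_log (real w)\<rfloor>" "\<forall>u\<in>verts G. \<forall>v\<in>verts G. E u v \<longrightarrow> c u \<noteq> c v"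
    unfolding P.colourable_def by blast
  have "proper_colouring G (nat \<lfloor>pow_log (real w)\<rfloor>) c" unfolding proper_colouring_def
    using c G.adj_in_verts unfolding E_def by blast
  then have "chromatic_number G \<le> nat \<lfloor>pow_log (real w)\<rfloor>"
    unfolding chromatic_number_def by (intro Least_le) blast
  then have "real (chromatic_number G) \<le> real (nat \<lfloor>pow_log (real w)\<rfloor>)" by simp
  also have "\<dots> \<le> pow_log (real w)" by (simp add: pow_log_def)
  finally show ?thesis by (simp add: pow_log_def w_def)
qed

end
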